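(* Assume that $\mathbb R^n=\mathbb R^{2d}$ is endowed with the canonical symplectic form. Let $A,B\in\mathrm{Sym}(n,\mathbb R)$ be linearly independent, and assume that $A,B$ form a non-dissipative pair. Define $C\in\mathrm{Sym}(n,\mathbb R)$ by $Q_C:=\{Q_A,Q_B\}$, the Poisson bracket of $Q_A$ and $Q_B$, and assume that $A,B$ and $C$ are linearly independent. Then there exists a point $x\in\mathbb R^n$ such that $$Q_A(x)=Q_B(x)=0\quad\text{and}\quad Q_C(x)\ne0,$$ provided one of the following conditions is satisfied: (i) $\operatorname{minrank}\{A,B\}\ge3$ and $\operatorname{maxrank}\{A,B\}\ge17$; (ii) $\operatorname{minrank}\{A,B\}=2$, $\operatorname{maxrank}\{A,B\}\ge9$, and the joint radical $\mathcal R_{A,B}:=\ker A\cap\ker B$ of $Q_A$ and $Q_B$ is either trivial, i.e., $\ker A\cap\ker B=\{0\}$, or a symplectic subspace of $\mathbb R^n$.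
   Context: $\mathrm{Sym}(n,\mathbb R)$ is the space of real symmetric $n\times n$ matrices; for $F\in\mathrm{Sym}(n,\mathbb R)$, $Q_F(z)={}^tzFz$. $A,B$ form a non-dissipative pair if $0$ is the only positive semidefinite element of $\mathrm{span}_{\mathbb R}\{A,B\}$. Moreover $$\operatorname{maxrank}\{A,B\}=\max\{\operatorname{rank}F:F\in\mathrm{span}_{\mathbb R}\{A,B\}\},$$ $$\operatorname{minrank}\{A,B\}=\min\{\operatorname{rank}F:F\in\mathrm{span}_{\mathbb R}\{A,B\},\ F\ne0\}.$$ In canonical coordinates $(x,\xi)\in\mathbb R^d\times\mathbb R^d$ the Poisson bracket is $\{a,b\}=\sum_{j=1}^d\left(\frac{\partial a}{\partial\xi_j}\frac{\partial b}{\partial x_j}-\frac{\partial a}{\partial x_j}\frac{\partial b}{\partial\xi_j}\right)$; the Poisson bracket of two quadratic forms is a quadratic form. A subspace is symplectic if the restriction of the symplectic form to it is non-degenerate. *)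

theory Defs
  imports "HOL-Analysis.Analysis"
begin

text \<open>
  The phase space of dimension \<open>2 d\<close> is \<open>real ^ ('d + 'd)\<close> with \<open>d = CARD('d)\<close>:
  the component \<open>z $ Inl j\<close> is the position coordinate \<open>x\<^sub>j\<close> and \<open>z $ Inr j\<close> is the momentum
  coordinate \<open>\<xi>\<^sub>j\<close>.
\<close>

definition quad_form :: "real ^ 'n ^ 'n \<Rightarrow> real ^ 'n \<Rightarrow> real" where
  "quad_form F z = z \<bullet> (F *v z)"

definition sym_matrix :: "real ^ 'n ^ 'n \<Rightarrow> bool" where
  "sym_matrix F \<longleftrightarrow> transpose F = F"

definition pos_semidef :: "real ^ 'n ^ 'n \<Rightarrow> bool" where
  "pos_semidef F \<longleftrightarrow> sym_matrix F \<and> (\<forall>z. 0 \<le> quad_form F z)"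

definition non_dissipative :: "real ^ 'n ^ 'n \<Rightarrow> real ^ 'n ^ 'n \<Rightarrow> bool" where
  "non_dissipative A B \<longleftrightarrow> {F \<in> span {A, B}. pos_semidef F} = {0}"

definition maxrank :: "real ^ 'n ^ 'n \<Rightarrow> real ^ 'n ^ 'n \<Rightarrow> nat" where
  "maxrank A B = Max (rank ` span {A, B})"

text \<open>Only meaningful if \<open>A\<close> and \<open>B\<close> are not both zero.\<close>

definition minrank :: "real ^ 'n ^ 'n \<Rightarrow> real ^ 'n ^ 'n \<Rightarrow> nat" where
  "minrank A B = Min (rank ` (span {A, B} - {0}))"

definition partial_deriv :: "'n \<Rightarrow> (real ^ 'n \<Rightarrow> real) \<Rightarrow> real ^ 'n \<Rightarrow> real" where
  "partial_deriv i f z = deriv (\<lambda>t. f (z + t *\<^sub>R axis i 1)) 0"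

definition poisson_bracket ::
  "(real ^ ('d::finite + 'd) \<Rightarrow> real) \<Rightarrow> (real ^ ('d + 'd) \<Rightarrow> real) \<Rightarrow> real ^ ('d + 'd) \<Rightarrow> real" where
  "poisson_bracket a b z =
     (\<Sum>j\<in>UNIV. partial_deriv (Inr j) a z * partial_deriv (Inl j) b z
              - partial_deriv (Inl j) a z * partial_deriv (Inr j) b z)"

text \<open>
  The sign is the one matching the bracket above, i.e. the form is the sum of the
  \<open>d\<xi>\<^sub>j \<and> dx\<^sub>j\<close>; non-degeneracy on a subspace does not depend on it.
\<close>

definition symplectic_form :: "real ^ ('d::finite + 'd) \<Rightarrow> real ^ ('d + 'd) \<Rightarrow> real" where
  "symplectic_form v w = (\<Sum>j\<in>UNIV. v $ Inr j * w $ Inl j - v $ Inl j * w $ Inr j)"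

definition symplectic_subspace :: "(real ^ ('d::finite + 'd)) set \<Rightarrow> bool" where
  "symplectic_subspace V \<longleftrightarrow>
     subspace V \<and> (\<forall>v\<in>V. (\<forall>w\<in>V. symplectic_form v w = 0) \<longrightarrow> v = 0)"

definition joint_radical :: "real ^ 'n ^ 'n \<Rightarrow> real ^ 'n ^ 'n \<Rightarrow> (real ^ 'n) set" where
  "joint_radical A B = {z. A *v z = 0} \<inter> {z. B *v z = 0}"

end

theory Submission
  imports Defs
begin

text \<open>
  Let \<open>P\<close> be the span of \<open>A\<close> and \<open>B\<close>, let \<open>V\<close> be the set of common zeros of its forms, and suppose
  that \<open>Q\<^sub>C\<close> vanishes on \<open>V\<close>; the aim is \<open>C \<in> P\<close>.

  Under (i), Lagrange multipliers at a regular point \<open>y\<close> of \<open>V\<close> give \<open>M\<^sub>y \<in> P\<close> with \<open>C - M\<^sub>y\<close> vanishing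
  on the tangent space, which has codimension 2, so \<open>rank (C - M\<^sub>y) \<le> 4\<close>. Two values of \<open>M\<close> differ by a
  matrix of rank at most 8, and as \<open>17 = 2 * 8 + 1\<close>, all these differences are multiples \<open>s\<^sub>y D\<close> of one
  \<open>D \<in> P\<close>. A vector that \<open>C - M\<^sub>y\<close> and \<open>D\<close> kill but a matrix of rank 17 does not improves the rank
  bound to \<open>rank (C - M\<^sub>y) \<le> 2\<close>. Since \<open>rank D \<ge> 3\<close>, this leaves finitely many values of \<open>s\<close>, so \<open>M\<close> is
  locally constant, and \<open>C = M\<close> because \<open>V\<close> spans the whole space near each regular point.

  Under (ii), \<open>P\<close> contains an indefinite form \<open>2 (l \<bullet> z) (m \<bullet> z)\<close> of rank 2, so \<open>V\<close> is the union of a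
  quadric \<open>Q\<^sub>E = 0\<close> in the hyperplane \<open>l = 0\<close> and one in the hyperplane \<open>m = 0\<close>. Where \<open>Q\<^sub>E\<close> is
  indefinite on such a hyperplane, the bracket of \<open>Q\<^sub>E\<close> with its linear form is a multiple of that form
  by Finsler's lemma; if it were semidefinite on one of them, \<open>P\<close> would contain a semidefinite matrix or
  the joint radical would be degenerate. If both brackets are multiples, \<open>C\<close> is proportional to the rank
  2 form.
\<close>

section \<open>Quadratic forms and ranks\<close>

lemma sym_matrix_inner:
  assumes "sym_matrix F"
  shows "x \<bullet> (F *v y) = (F *v x) \<bullet> y"
  using assms by (metis dot_lmul_matrix sym_matrix_def vector_transpose_matrix)

lemma quad_form_add:
  assumes "sym_matrix F"
  shows "quad_form F (x + y) = quad_form F x + 2 * ((F *v x) \<bullet> y) + quad_form F y"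
  using sym_matrix_inner[OF assms, of x y] inner_commute[of y "F *v x"]
  by (simp add: quad_form_def matrix_vector_right_distrib inner_add_left inner_add_right)

lemma quad_form_scaleR: "quad_form F (c *\<^sub>R x) = c\<^sup>2 * quad_form F x"
  by (simp add: quad_form_def matrix_vector_mult_scaleR power2_eq_square)

lemma quad_form_matrix_add: "quad_form (M + N) x = quad_form M x + quad_form N x"
  by (simp add: quad_form_def matrix_vector_mult_add_rdistrib inner_add_right)

lemma quad_form_matrix_diff: "quad_form (M - N) x = quad_form M x - quad_form N x"
  by (simp add: quad_form_def matrix_vector_mult_diff_rdistrib inner_diff_right)

lemma quad_form_matrix_scaleR: "quad_form (c *\<^sub>R M) x = c * quad_form M x"
  by (simp add: quad_form_def flip: scaleR_matrix_vector_assoc)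

lemma quad_form_matrix_uminus: "quad_form (- M) x = - quad_form M x"
  using quad_form_matrix_scaleR[of "-1" M x] by simp

lemma continuous_quad_form: "continuous_on S (\<lambda>x. quad_form F x)"
  unfolding quad_form_def by (intro continuous_intros)

lemma sym_matrix_add: "sym_matrix M \<Longrightarrow> sym_matrix N \<Longrightarrow> sym_matrix (M + N)"
  by (simp add: sym_matrix_def transpose_def vec_eq_iff)

lemma sym_matrix_scaleR: "sym_matrix M \<Longrightarrow> sym_matrix (c *\<^sub>R M)"
  by (simp add: sym_matrix_def transpose_def vec_eq_iff)

lemma sym_matrix_diff: "sym_matrix M \<Longrightarrow> sym_matrix N \<Longrightarrow> sym_matrix (M - N)"
  by (simp add: sym_matrix_def transpose_def vec_eq_iff)

lemma sym_matrix_uminus: "sym_matrix M \<Longrightarrow> sym_matrix (- M)"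
  by (simp add: sym_matrix_def transpose_def vec_eq_iff)

lemma sym_matrix_eq_0:
  assumes "sym_matrix F" "\<And>x. quad_form F x = 0"
  shows "F = 0"
proof -
  have "(F *v x) \<bullet> y = 0" for x y
    using quad_form_add[OF assms(1), of x y] assms(2) by simp
  then have "F *v x = 0" for x by (metis inner_eq_zero_iff)
  then show ?thesis by (simp add: matrix_eq)
qed

section \<open>Orthogonal complements, spans and rank estimates\<close>

lemma ex_decomp:
  fixes w :: "'a::euclidean_space"
  obtains s r where "s \<in> span N" "\<And>a. a \<in> span N \<Longrightarrow> a \<bullet> r = 0" "w = s + r"
proof -
  obtain y z where "y \<in> span N" "\<And>w. w \<in> span N \<Longrightarrow> orthogonal z w" "w = y + z"
    using orthogonal_subspace_decomp_exists[of N w] by blast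
  then show thesis using that[of y z] by (simp add: orthogonal_def inner_commute)
qed

lemma in_span_if_orthogonal:
  fixes w :: "'a::euclidean_space"
  assumes "\<And>v. (\<And>a. a \<in> N \<Longrightarrow> a \<bullet> v = 0) \<Longrightarrow> w \<bullet> v = 0"
  shows "w \<in> span N"
proof -
  obtain s r where sr: "s \<in> span N" "\<And>a. a \<in> span N \<Longrightarrow> a \<bullet> r = 0" "w = s + r"
    using ex_decomp by blast
  have "w \<bullet> r = 0" using assms sr(2) by (simp add: span_base)
  then have "r \<bullet> r = 0" using sr by (simp add: inner_add_left)
  then show ?thesis using sr by simp
qed

lemma in_span2: "M \<in> span {A, B} \<longleftrightarrow> (\<exists>a b. M = a *\<^sub>R A + b *\<^sub>R B)"
proof
  assume "M \<in> span {A, B}"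
  then obtain a where "M - a *\<^sub>R A \<in> span {B}" by (auto simp: span_breakdown_eq)
  then obtain b where "M - a *\<^sub>R A = b *\<^sub>R B" by (auto simp: span_singleton)
  then show "\<exists>a b. M = a *\<^sub>R A + b *\<^sub>R B" by (metis add.commute diff_add_cancel)
next
  have "A \<in> span {A, B}" "B \<in> span {A, B}" by (auto intro: span_base)
  then show "\<exists>a b. M = a *\<^sub>R A + b *\<^sub>R B \<Longrightarrow> M \<in> span {A, B}"
    by (auto intro: span_add span_scale)
qed

text \<open>By polarization the bilinear form of \<open>F\<close> vanishes on the orthogonal
  complement of \<open>N\<close>, so \<open>F\<close> sends this complement into
  \<open>span N\<close>; the summand \<open>span N\<close> contributes only the image of
  \<open>N\<close>. These two pieces are the source of the factor 2 in the rank bound below.\<close>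

lemma range_quad_form_zero:
  fixes F :: "real ^ 'n ^ 'n"
  assumes "sym_matrix F"
    and "\<And>x. (\<And>a. a \<in> N \<Longrightarrow> a \<bullet> x = 0) \<Longrightarrow> quad_form F x = 0"
  shows "range ((*v) F) \<subseteq> span (N \<union> (*v) F ` N)"
proof -
  have polar: "(F *v x) \<bullet> y = 0"
    if "\<And>a. a \<in> N \<Longrightarrow> a \<bullet> x = 0" "\<And>a. a \<in> N \<Longrightarrow> a \<bullet> y = 0" for x y
    using quad_form_add[OF assms(1), of x y] assms(2)[of x] assms(2)[of y] assms(2)[of "x + y"] that
    by (simp add: inner_add_right)
  have "F *v w \<in> span (N \<union> (*v) F ` N)" for w
  proof -
    obtain s r where sr: "s \<in> span N" "\<And>a. a \<in> span N \<Longrightarrow> a \<bullet> r = 0" "w = s + r"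
      using ex_decomp by blast
    have "F *v r \<in> span N"
      by (rule in_span_if_orthogonal) (metis polar sr(2) span_base)
    moreover have "F *v s \<in> span ((*v) F ` N)"
      using sr(1) linear_span_image[OF matrix_vector_mul_linear, of F N] by blast
    ultimately show ?thesis
      unfolding sr(3) matrix_vector_right_distrib
      by (meson span_add span_mono subsetD sup_ge1 sup_ge2)
  qed
  then show ?thesis by blast
qed

lemma rank_le_card:
  fixes F :: "real ^ 'n ^ 'm"
  assumes "finite X" "range ((*v) F) \<subseteq> span X"
  shows "rank F \<le> card X"
  unfolding rank_dim_range using assms(2,1) by (rule dim_le_card)

lemma rank_quad_form_zero:
  fixes F :: "real ^ 'n ^ 'n"
  assumes "sym_matrix F" "finite N"
    and "\<And>x. (\<And>a. a \<in> N \<Longrightarrow> a \<bullet> x = 0) \<Longrightarrow> quad_form F x = 0"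
  shows "rank F \<le> 2 * card N"
proof -
  have "rank F \<le> card (N \<union> (*v) F ` N)"
    using range_quad_form_zero[OF assms(1,3)] assms(2) by (intro rank_le_card) auto
  also have "\<dots> \<le> card N + card ((*v) F ` N)" by (rule card_Un_le)
  also have "\<dots> \<le> 2 * card N" using card_image_le[OF assms(2), of "(*v) F"] by simp
  finally show ?thesis .
qed

lemma rank_kernel:
  fixes F :: "real ^ 'n ^ 'n"
  assumes "finite N" and "\<And>x. (\<And>a. a \<in> N \<Longrightarrow> a \<bullet> x = 0) \<Longrightarrow> F *v x = 0"
  shows "rank F \<le> card N"
proof -
  have "F *v w \<in> span ((*v) F ` N)" for w
  proof -
    obtain s r where sr: "s \<in> span N" "\<And>a. a \<in> span N \<Longrightarrow> a \<bullet> r = 0" "w = s + r"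
      using ex_decomp by blast
    have "F *v r = 0" using assms(2) sr(2) by (simp add: span_base)
    moreover have "F *v s \<in> span ((*v) F ` N)"
      using sr(1) linear_span_image[OF matrix_vector_mul_linear, of F N] by blast
    ultimately show ?thesis by (simp add: sr(3) matrix_vector_right_distrib)
  qed
  then have "rank F \<le> card ((*v) F ` N)" using assms(1) by (intro rank_le_card) auto
  then show ?thesis using card_image_le[OF assms(1), of "(*v) F"] by simp
qed

lemma rank_add_le: "rank (M + N) \<le> rank M + rank (N :: real ^ 'n ^ 'm)"
proof -
  have "dim (range ((*v) (M + N))) \<le> dim {x + y |x y. x \<in> range ((*v) M) \<and> y \<in> range ((*v) N)}"
    by (rule dim_subset) (auto simp: matrix_vector_mult_add_rdistrib)
  also have "\<dots> \<le> dim (range ((*v) M)) + dim (range ((*v) N))"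
    using dim_sums_Int[of "range ((*v) M)" "range ((*v) N)"]
    by (simp add: linear_subspace_image)
  finally show ?thesis by (simp add: rank_dim_range)
qed

lemma rank_scaleR_le: "rank (c *\<^sub>R M) \<le> rank (M :: real ^ 'n ^ 'm)"
proof -
  have "range ((*v) (c *\<^sub>R M)) \<subseteq> span (range ((*v) M))"
    by (auto simp: span_scale span_base simp flip: scaleR_matrix_vector_assoc)
  then have "dim (range ((*v) (c *\<^sub>R M))) \<le> dim (span (range ((*v) M)))" by (rule dim_subset)
  then show ?thesis by (simp add: rank_dim_range)
qed

lemma rank_diff_le: "rank (M - N) \<le> rank M + rank (N :: real ^ 'n ^ 'm)"
  using rank_add_le[of M "(-1) *\<^sub>R N"] rank_scaleR_le[of "-1" N] by simp

text \<open>The range of a symmetric matrix is the orthogonal complement of its kernel, so the range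
  of \<open>E\<close> lies in the sum of the ranges of \<open>C\<close> and \<open>D\<close>. Used
  contrapositively, to find a vector that \<open>C\<close> and \<open>D\<close> kill and
  \<open>E\<close> does not.\<close>

lemma rank_le_if_kernel_Int:
  fixes E C D :: "real ^ 'n ^ 'n"
  assumes "sym_matrix E" "sym_matrix C" "sym_matrix D"
    and "\<And>k. C *v k = 0 \<Longrightarrow> D *v k = 0 \<Longrightarrow> E *v k = 0"
  shows "rank E \<le> rank C + rank D"
proof -
  let ?S = "range ((*v) C) \<union> range ((*v) D)"
  have "E *v z \<in> span ?S" for z
  proof (rule in_span_if_orthogonal)
    fix v assume v: "\<And>a. a \<in> ?S \<Longrightarrow> a \<bullet> v = 0"
    have "C *v v = 0" using v[of "C *v (C *v v)"] sym_matrix_inner[OF assms(2), of "C *v v" v]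
      by (simp add: inner_commute)
    moreover have "D *v v = 0" using v[of "D *v (D *v v)"] sym_matrix_inner[OF assms(3), of "D *v v" v]
      by (simp add: inner_commute)
    ultimately have "E *v v = 0" by (rule assms(4))
    then show "(E *v z) \<bullet> v = 0" by (simp flip: sym_matrix_inner[OF assms(1)])
  qed
  then have "dim (range ((*v) E)) \<le> dim (span ?S)" by (intro dim_subset) auto
  also have "span ?S = {x + y |x y. x \<in> range ((*v) C) \<and> y \<in> range ((*v) D)}"
    unfolding span_Un by (simp only: span_eq_iff[THEN iffD2, OF linear_subspace_image[OF matrix_vector_mul_linear subspace_UNIV]])
  also have "dim \<dots> \<le> dim (range ((*v) C)) + dim (range ((*v) D))"
    using dim_sums_Int[of "range ((*v) C)" "range ((*v) D)"]
    by (simp add: linear_subspace_image)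
  finally show ?thesis by (simp add: rank_dim_range)
qed

section \<open>Zeros of indefinite forms on lines, and Finsler's lemma\<close>

lemma quad_form_roots:
  assumes "sym_matrix F" "quad_form F a > 0" "quad_form F b < 0"
  obtains p q where "p < 0" "0 < q" "p * q * quad_form F b = quad_form F a"
    "quad_form F (a + p *\<^sub>R b) = 0" "quad_form F (a + q *\<^sub>R b) = 0"
    "(F *v (a + p *\<^sub>R b)) \<bullet> b \<noteq> 0" "(F *v (a + q *\<^sub>R b)) \<bullet> b \<noteq> 0"
proof -
  define \<alpha> \<beta> \<gamma> where "\<alpha> = quad_form F a" and "\<beta> = (F *v a) \<bullet> b" and "\<gamma> = - quad_form F b"
  \<comment> \<open>Along the line the form is \<alpha> + 2 t \<beta> - t^2 \<gamma>. As \<alpha>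
    and \<gamma> are positive, the roots (\<beta> +- d) / \<gamma> are real, simple and of opposite
    sign; simplicity makes the derivative along \<open>b\<close> nonzero there.\<close>
  define d where "d = sqrt (\<beta>\<^sup>2 + \<alpha> * \<gamma>)"
  have pos: "\<alpha> > 0" "\<gamma> > 0" using assms by (auto simp: \<alpha>_def \<gamma>_def)
  have d2: "d\<^sup>2 = \<beta>\<^sup>2 + \<alpha> * \<gamma>" using pos by (simp add: d_def)
  have "\<bar>\<beta>\<bar> < d" unfolding d_def using pos by (intro real_less_rsqrt) simp
  then have d: "\<beta> < d" "- \<beta> < d" "d > 0" by auto
  have Q: "quad_form F (a + t *\<^sub>R b) = \<alpha> + 2 * t * \<beta> - t\<^sup>2 * \<gamma>" for t
    by (simp add: quad_form_add[OF assms(1)] quad_form_scaleR \<alpha>_def \<beta>_def \<gamma>_def)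
  have G: "(F *v (a + t *\<^sub>R b)) \<bullet> b = \<beta> - t * \<gamma>" for t
    by (simp add: \<beta>_def \<gamma>_def quad_form_def matrix_vector_right_distrib matrix_vector_mult_scaleR
        inner_add_left inner_add_right inner_commute)
  define p q where "p = (\<beta> - d) / \<gamma>" and "q = (\<beta> + d) / \<gamma>"
  have pg: "p * \<gamma> = \<beta> - d" "q * \<gamma> = \<beta> + d" using pos by (auto simp: p_def q_def)
  have root: "\<alpha> + 2 * t * \<beta> - t\<^sup>2 * \<gamma> = 0" if "(t * \<gamma> - \<beta>)\<^sup>2 = d\<^sup>2" for t
  proof -
    have "\<gamma> * (\<alpha> + 2 * t * \<beta> - t\<^sup>2 * \<gamma>) = 0"
      using that d2 by (simp add: power2_eq_square algebra_simps)
    then show ?thesis using pos by simp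
  qed
  have "\<gamma> * (p * q * \<gamma>) = (\<beta> - d) * (\<beta> + d)" using pg by (metis mult.assoc mult.commute)
  also have "\<dots> = - (\<gamma> * \<alpha>)" using d2 by (simp add: power2_eq_square algebra_simps)
  finally have "p * q * \<gamma> = - \<alpha>" using pos by (metis mult_cancel_left mult_minus_right less_irrefl)
  moreover have "p < 0" "q > 0" using d pos by (auto simp: p_def q_def divide_simps)
  moreover have "\<alpha> + 2 * p * \<beta> - p\<^sup>2 * \<gamma> = 0" "\<alpha> + 2 * q * \<beta> - q\<^sup>2 * \<gamma> = 0"
    by (rule root, simp add: pg)+
  moreover have "\<beta> - p * \<gamma> \<noteq> 0" "\<beta> - q * \<gamma> \<noteq> 0" using d(3) by (simp_all add: pg)
  moreover have "p * q * quad_form F b = quad_form F a"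
    using \<open>p * q * \<gamma> = - \<alpha>\<close> by (simp add: \<alpha>_def \<gamma>_def)
  ultimately show thesis using that[of p q] unfolding Q G by blast
qed

text \<open>Evaluating \<open>Q\<^sub>B\<close> at the two zeros of \<open>Q\<^sub>D\<close> on the line through points where \<open>Q\<^sub>D\<close> has
  opposite signs, and eliminating the mixed term, separates the values of \<open>Q\<^sub>B / Q\<^sub>D\<close>.\<close>

lemma finsler:
  fixes B D :: "real ^ 'n ^ 'n"
  assumes "sym_matrix B" "sym_matrix D" "subspace S"
    and "x0 \<in> S" "quad_form D x0 > 0" "y0 \<in> S" "quad_form D y0 < 0"
    and nonneg: "\<And>x. x \<in> S \<Longrightarrow> quad_form D x = 0 \<Longrightarrow> quad_form B x \<ge> 0"
  obtains t where "\<And>x. x \<in> S \<Longrightarrow> quad_form B x \<ge> t * quad_form D x"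
proof -
  let ?r = "\<lambda>x. quad_form B x / quad_form D x"
  have sep: "?r y \<le> ?r x"
    if "x \<in> S" "y \<in> S" and pos: "quad_form D x > 0" and neg: "quad_form D y < 0" for x y
  proof -
    obtain p q where pq: "p < 0" "0 < q" "p * q * quad_form D y = quad_form D x"
      "quad_form D (x + p *\<^sub>R y) = 0" "quad_form D (x + q *\<^sub>R y) = 0"
      using quad_form_roots[OF assms(2) pos neg] by metis
    have "0 \<le> quad_form B (x + t *\<^sub>R y)" if "t = p \<or> t = q" for t
      using that pq nonneg \<open>x \<in> S\<close> \<open>y \<in> S\<close> assms(3) by (auto simp: subspace_add subspace_scale)
    then have "0 \<le> quad_form B x + 2 * t * ((B *v x) \<bullet> y) + t\<^sup>2 * quad_form B y" if "t = p \<or> t = q" for t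
      using that by (force simp: quad_form_add[OF assms(1)] quad_form_scaleR)
    \<comment> \<open>Weighting the two inequalities by the positive numbers \<open>q\<close> and
      \<open>- p\<close> cancels the mixed term.\<close>
    then have "0 \<le> q * (quad_form B x + 2 * p * ((B *v x) \<bullet> y) + p\<^sup>2 * quad_form B y)
        + (- p) * (quad_form B x + 2 * q * ((B *v x) \<bullet> y) + q\<^sup>2 * quad_form B y)"
      using pq(1,2) less_imp_le by (intro add_nonneg_nonneg mult_nonneg_nonneg \<open>\<And>t. t = p \<or> t = q \<Longrightarrow> 0 \<le> quad_form B x + 2 * t * ((B *v x) \<bullet> y) + t\<^sup>2 * quad_form B y\<close>) auto
    also have "\<dots> = (q - p) * (quad_form B x - p * q * quad_form B y)"
      by (simp add: algebra_simps power2_eq_square)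
    finally have "0 \<le> quad_form B x - p * q * quad_form B y" using pq by (simp add: zero_le_mult_iff)
    also have "p * q = quad_form D x / quad_form D y" using pq(3) neg by (simp add: field_simps)
    finally have "quad_form D x * ?r y \<le> quad_form B x" by simp
    then show ?thesis using pos by (simp add: pos_le_divide_eq mult.commute)
  qed
  define t where "t = Sup (?r ` {y \<in> S. quad_form D y < 0})"
  have ub: "t \<le> ?r x" if "x \<in> S" "quad_form D x > 0" for x
    unfolding t_def using assms(6,7) sep that by (intro cSup_least) auto
  have lb: "?r y \<le> t" if "y \<in> S" "quad_form D y < 0" for y
    unfolding t_def using assms(4,5) sep that by (intro cSup_upper) (auto simp: bdd_above_def)
  have "quad_form B x \<ge> t * quad_form D x" if "x \<in> S" for x
  proof (cases "quad_form D x" "0 :: real" rule: linorder_cases)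
    case less then show ?thesis using lb[OF that] by (simp add: neg_divide_le_eq)
  next
    case greater then show ?thesis using ub[OF that] by (simp add: pos_le_divide_eq)
  qed (use nonneg that in simp)
  then show thesis using that by blast
qed

section \<open>Regular isotropic points of a pencil\<close>

definition isotropic :: "(real ^ 'n ^ 'n) set \<Rightarrow> (real ^ 'n) set" where
  "isotropic P = {x. \<forall>M\<in>P. quad_form M x = 0}"

text \<open>For symmetric \<open>M\<close> the gradient of \<open>quad_form M\<close> at
  \<open>x\<close> is twice \<open>M *v x\<close>. In a two-dimensional \<open>P\<close> this is
  therefore the independence of the gradients of a basis, stated without choosing one.\<close>

definition regular :: "(real ^ 'n ^ 'n) set \<Rightarrow> real ^ 'n \<Rightarrow> bool" where
  "regular P x \<longleftrightarrow> (\<forall>M\<in>P. M *v x = 0 \<longrightarrow> M = 0)"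

definition tangent :: "(real ^ 'n ^ 'n) set \<Rightarrow> real ^ 'n \<Rightarrow> (real ^ 'n) set" where
  "tangent P x = {v. \<forall>M\<in>P. (M *v x) \<bullet> v = 0}"

lemma linear_matrix_vector_left: "linear (\<lambda>M :: real ^ 'n ^ 'm. M *v x)"
  by (rule linearI) (simp_all add: matrix_vector_mult_add_rdistrib flip: scaleR_matrix_vector_assoc)

lemma ex_dual:
  fixes a b :: "'a::euclidean_space"
  assumes "a \<notin> span {b}"
  obtains e where "a \<bullet> e = 1" "b \<bullet> e = 0"
proof -
  obtain v where v: "b \<bullet> v = 0" "a \<bullet> v \<noteq> 0"
    using in_span_if_orthogonal[of "{b}" a] assms by auto
  then show thesis using that[of "(1 / (a \<bullet> v)) *\<^sub>R v"] by simp
qed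

section \<open>Bases and regular points of a two-dimensional space of forms\<close>

locale pencil =
  fixes P :: "(real ^ 'n ^ 'n) set"
  assumes subspace: "subspace P" and dim: "dim P = 2"
    and sym: "\<And>M. M \<in> P \<Longrightarrow> sym_matrix M"
begin

lemma basis:
  assumes "M \<in> P" "M \<noteq> 0" "N \<in> P" "\<And>c. N \<noteq> c *\<^sub>R M" "X \<in> P"
  obtains a b where "X = a *\<^sub>R M + b *\<^sub>R N"
proof -
  have "N \<noteq> M" using assms(4)[of 1] by simp
  moreover have "N \<notin> span {M}" using assms(4) by (auto simp: span_singleton)
  ultimately have "independent {N, M}" using assms(2) by (simp add: independent_insert)
  then have "P \<subseteq> span {N, M}"
    using assms(1,3) \<open>N \<noteq> M\<close> by (intro card_ge_dim_independent) (auto simp: dim)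
  then obtain b a where "X = b *\<^sub>R N + a *\<^sub>R M" using assms(5) in_span2 by blast
  then show thesis using that[of a b] by (simp add: add.commute)
qed

lemma ex_nonmultiple:
  obtains N where "N \<in> P" "\<And>c. N \<noteq> c *\<^sub>R M"
proof -
  have "\<not> P \<subseteq> span {M}"
  proof
    assume "P \<subseteq> span {M}"
    then have "dim P \<le> card {M}" by (rule dim_le_card) simp
    then show False by (simp add: dim)
  qed
  then show thesis using that by (auto simp: span_singleton)
qed

lemma ex_basis:
  obtains M N where "M \<in> P" "M \<noteq> 0" "N \<in> P" "\<And>c. N \<noteq> c *\<^sub>R M"
proof -
  obtain M where "M \<in> P" "\<And>c. M \<noteq> c *\<^sub>R 0" using ex_nonmultiple by blast
  moreover obtain N where "N \<in> P" "\<And>c. N \<noteq> c *\<^sub>R M" using ex_nonmultiple by blast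
  ultimately show thesis using that by simp
qed

text \<open>Otherwise \<open>D\<close> and \<open>D'\<close> would form a basis of \<open>P\<close>,
  and every rank in \<open>P\<close> would be at most \<open>2 * k\<close>.\<close>

lemma low_rank_multiple:
  assumes "D \<in> P" "D \<noteq> 0" "D' \<in> P" "rank D \<le> k" "rank D' \<le> k" "E \<in> P" "rank E > 2 * k"
  obtains c where "D' = c *\<^sub>R D"
proof (cases "\<exists>c. D' = c *\<^sub>R D")
  case False
  then obtain a b where "E = a *\<^sub>R D + b *\<^sub>R D'" using basis[OF assms(1-3) _ assms(6)] by blast
  then have "rank E \<le> rank D + rank D'"
    using rank_add_le[of "a *\<^sub>R D" "b *\<^sub>R D'"] rank_scaleR_le[of a D] rank_scaleR_le[of b D'] by simp
  then show thesis using assms by simp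
qed (use that in blast)

lemma isotropicI:
  assumes "M \<in> P" "M \<noteq> 0" "N \<in> P" "\<And>c. N \<noteq> c *\<^sub>R M"
    and "quad_form M x = 0" "quad_form N x = 0"
  shows "x \<in> isotropic P"
  unfolding isotropic_def
proof safe
  fix X assume "X \<in> P"
  then obtain a b where "X = a *\<^sub>R M + b *\<^sub>R N" using basis[OF assms(1-4)] by blast
  then show "quad_form X x = 0" by (simp add: quad_form_matrix_add quad_form_matrix_scaleR assms)
qed

lemma tangentI:
  assumes "M \<in> P" "M \<noteq> 0" "N \<in> P" "\<And>c. N \<noteq> c *\<^sub>R M"
    and "(M *v x) \<bullet> v = 0" "(N *v x) \<bullet> v = 0"
  shows "v \<in> tangent P x"
  unfolding tangent_def
proof safe
  fix X assume "X \<in> P"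
  then obtain a b where "X = a *\<^sub>R M + b *\<^sub>R N" using basis[OF assms(1-4)] by blast
  then show "(X *v x) \<bullet> v = 0"
    using assms(5,6) by (simp add: matrix_vector_mult_add_rdistrib inner_add_left flip: scaleR_matrix_vector_assoc)
qed

text \<open>The last hypothesis is a nonzero 2 by 2 minor of the two gradients in the directions
  \<open>e\<close> and \<open>f\<close>. It depends continuously on \<open>x\<close>, which makes
  regularity an open condition.\<close>

lemma regularI:
  assumes "M \<in> P" "M \<noteq> 0" "N \<in> P" "\<And>c. N \<noteq> c *\<^sub>R M"
    and "(M *v x) \<bullet> e * ((N *v x) \<bullet> f) - (M *v x) \<bullet> f * ((N *v x) \<bullet> e) \<noteq> 0"
  shows "regular P x"
  unfolding regular_def
proof safe
  fix X assume "X \<in> P" and X0: "X *v x = 0"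
  then obtain a b where X: "X = a *\<^sub>R M + b *\<^sub>R N" using basis[OF assms(1-4)] by blast
  define m1 m2 n1 n2 where "m1 = (M *v x) \<bullet> e" "m2 = (M *v x) \<bullet> f" "n1 = (N *v x) \<bullet> e" "n2 = (N *v x) \<bullet> f"
  have "(X *v x) \<bullet> w = a * ((M *v x) \<bullet> w) + b * ((N *v x) \<bullet> w)" for w
    by (simp add: X matrix_vector_mult_add_rdistrib inner_add_left flip: scaleR_matrix_vector_assoc)
  then have "a * m1 + b * n1 = 0" "a * m2 + b * n2 = 0"
    using X0 by (metis inner_zero_left m1_m2_n1_n2_def)+
  then have "a * (m1 * n2 - m2 * n1) = 0" "b * (m1 * n2 - m2 * n1) = 0" by algebra+
  then have "a = 0" "b = 0" using assms(5) by (simp_all add: m1_m2_n1_n2_def)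
  then show "X = 0" by (simp add: X)
qed

text \<open>Moving along \<open>e\<close> and \<open>f\<close> prescribes the linearized values of
  the two forms independently of each other.\<close>

lemma regular_duals:
  assumes "M \<in> P" "M \<noteq> 0" "N \<in> P" "\<And>c. N \<noteq> c *\<^sub>R M" "regular P x"
  obtains e f where "(M *v x) \<bullet> e = 1" "(N *v x) \<bullet> e = 0" "(M *v x) \<bullet> f = 0" "(N *v x) \<bullet> f = 1"
proof -
  have indep: "a = 0 \<and> b = 0" if "a *\<^sub>R (M *v x) + b *\<^sub>R (N *v x) = 0" for a b
  proof -
    have "a *\<^sub>R M + b *\<^sub>R N \<in> P" using assms subspace by (simp add: subspace_add subspace_scale)
    moreover have "(a *\<^sub>R M + b *\<^sub>R N) *v x = 0"
      using that by (simp add: matrix_vector_mult_add_rdistrib flip: scaleR_matrix_vector_assoc)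
    ultimately have *: "a *\<^sub>R M + b *\<^sub>R N = 0" using assms(5) by (auto simp: regular_def)
    have "b = 0"
    proof (rule ccontr)
      assume "b \<noteq> 0"
      then have "N = (- a / b) *\<^sub>R M"
        using arg_cong[OF *, of "\<lambda>Z. (1 / b) *\<^sub>R Z"] by (simp add: scaleR_right_distrib eq_neg_iff_add_eq_0 add.commute)
      then show False using assms(4) by blast
    qed
    then show ?thesis using * assms(2) by simp
  qed
  have "M *v x \<notin> span {N *v x}"
  proof
    assume "M *v x \<in> span {N *v x}"
    then obtain k where "M *v x = k *\<^sub>R (N *v x)" by (auto simp: span_singleton)
    then show False using indep[of 1 "-k"] by simp
  qed
  moreover have "N *v x \<notin> span {M *v x}"
  proof
    assume "N *v x \<in> span {M *v x}"
    then obtain k where "N *v x = k *\<^sub>R (M *v x)" by (auto simp: span_singleton)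
    then show False using indep[of "-k" 1] by simp
  qed
  ultimately show thesis using that ex_dual by metis
qed

section \<open>The isotropic set near a regular point\<close>

lemma regular_open:
  assumes "regular P x"
  obtains \<rho> where "\<rho> > 0" "\<And>y. dist x y < \<rho> \<Longrightarrow> regular P y"
proof -
  obtain M N where MN: "M \<in> P" "M \<noteq> 0" "N \<in> P" "\<And>c. N \<noteq> c *\<^sub>R M" using ex_basis by blast
  then obtain e f where ef: "(M *v x) \<bullet> e = 1" "(N *v x) \<bullet> e = 0" "(M *v x) \<bullet> f = 0" "(N *v x) \<bullet> f = 1"
    using regular_duals assms by metis
  let ?h = "\<lambda>y. (M *v y) \<bullet> e * ((N *v y) \<bullet> f) - (M *v y) \<bullet> f * ((N *v y) \<bullet> e)"
  have "open {y. ?h y \<noteq> 0}" by (intro open_Collect_neq continuous_intros)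
  moreover have "x \<in> {y. ?h y \<noteq> 0}" by (simp add: ef)
  ultimately obtain \<rho> where "\<rho> > 0" "ball x \<rho> \<subseteq> {y. ?h y \<noteq> 0}" by (meson open_contains_ball)
  then show thesis using regularI[OF MN] that[of \<rho>] by (auto simp: subset_iff)
qed

text \<open>Rescaling the correction term turns solving the two equations near \<open>x + \<epsilon> v\<close> into a fixed
  point problem for a map that is uniformly of size \<open>O(\<epsilon>)\<close>.\<close>

lemma tangent_approx:
  assumes "x \<in> isotropic P" "regular P x" "v \<in> tangent P x" "\<delta> > 0"
  obtains \<epsilon> r where "0 < \<epsilon>" "\<epsilon> < \<delta>" "norm r \<le> \<delta>" "x + \<epsilon> *\<^sub>R (v + r) \<in> isotropic P"
proof -
  obtain M N where MN: "M \<in> P" "M \<noteq> 0" "N \<in> P" "\<And>c. N \<noteq> c *\<^sub>R M" using ex_basis by blast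
  then obtain e f where ef: "(M *v x) \<bullet> e = 1" "(N *v x) \<bullet> e = 0" "(M *v x) \<bullet> f = 0" "(N *v x) \<bullet> f = 1"
    using regular_duals assms by metis
  \<comment> \<open>For isotropic \<open>x\<close> and tangent \<open>v\<close>, a form
    \<open>X\<close> vanishes at \<open>x + \<epsilon> *\<^sub>R (v + r)\<close> as soon as
    \<open>(X *v x) \<bullet> r\<close> equals \<open>- \<epsilon> / 2\<close> times its value at
    \<open>v + r\<close>. Since \<open>e\<close> and \<open>f\<close> are dual to the gradients, a
    fixed point of \<open>- \<epsilon> / 2\<close> times \<open>g\<close> satisfies this for
    \<open>M\<close> and \<open>N\<close> at once.\<close>
  define g where "g = (\<lambda>r. quad_form M (v + r) *\<^sub>R e + quad_form N (v + r) *\<^sub>R f)"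
  have cont: "continuous_on (cball 0 \<delta>) g"
    unfolding g_def by (intro continuous_intros continuous_on_compose2[OF continuous_quad_form]) auto
  then have "bounded (g ` cball 0 \<delta>)" by (intro compact_imp_bounded compact_continuous_image) auto
  then obtain K where K: "K > 0" "\<And>r. r \<in> cball 0 \<delta> \<Longrightarrow> norm (g r) \<le> K"
    by (auto simp: bounded_pos)
  \<comment> \<open>With this choice the rescaled \<open>g\<close> maps
    \<open>cball 0 \<delta>\<close> into itself, as Brouwer's theorem requires.\<close>
  define \<epsilon> where "\<epsilon> = min (\<delta> / 2) (\<delta> / K)"
  have \<epsilon>: "0 < \<epsilon>" "\<epsilon> < \<delta>" "\<epsilon> * K \<le> \<delta>"
    using assms(4) K(1) by (auto simp: \<epsilon>_def min_def field_simps)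
  have "(\<lambda>r. (- \<epsilon> / 2) *\<^sub>R g r) \<in> cball 0 \<delta> \<rightarrow> cball 0 \<delta>"
  proof
    fix r :: "real ^ 'n" assume "r \<in> cball 0 \<delta>"
    then have "\<epsilon> * norm (g r) \<le> \<delta>" using K(2) \<epsilon> by (meson less_imp_le mult_left_mono order_trans)
    moreover have "0 \<le> \<epsilon> * norm (g r)" using \<epsilon> by simp
    ultimately have "norm ((- \<epsilon> / 2) *\<^sub>R g r) \<le> \<delta>" using \<epsilon>(1) assms(4) by simp
    then show "(- \<epsilon> / 2) *\<^sub>R g r \<in> cball 0 \<delta>" by simp
  qed
  moreover have "continuous_on (cball 0 \<delta>) (\<lambda>r. (- \<epsilon> / 2) *\<^sub>R g r)"
    by (intro continuous_intros cont)
  ultimately obtain r where r: "r \<in> cball 0 \<delta>" "(- \<epsilon> / 2) *\<^sub>R g r = r"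
    using brouwer_ball[OF assms(4)] by metis
  have zero: "quad_form X (x + \<epsilon> *\<^sub>R (v + r)) = 0"
    if "X \<in> P" and "(X *v x) \<bullet> r = (- \<epsilon> / 2) * quad_form X (v + r)" for X
  proof -
    have "quad_form X x = 0" "(X *v x) \<bullet> v = 0"
      using assms that by (auto simp: isotropic_def tangent_def)
    then show ?thesis using that(2)
      by (simp add: quad_form_add[OF sym[OF \<open>X \<in> P\<close>], of x] quad_form_scaleR inner_add_right power2_eq_square)
  qed
  have M: "(M *v x) \<bullet> ((- \<epsilon> / 2) *\<^sub>R g r) = (- \<epsilon> / 2) * quad_form M (v + r)"
    by (simp add: g_def inner_add_right ef)
  have N: "(N *v x) \<bullet> ((- \<epsilon> / 2) *\<^sub>R g r) = (- \<epsilon> / 2) * quad_form N (v + r)"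
    by (simp add: g_def inner_add_right ef)
  have "x + \<epsilon> *\<^sub>R (v + r) \<in> isotropic P" 
    using isotropicI[OF MN] zero[OF MN(1)] zero[OF MN(3)] M[unfolded r(2)] N[unfolded r(2)] by blast
  then show thesis using that \<epsilon> r(1) by simp
qed

lemma tangent_sequence:
  assumes "x \<in> isotropic P" "regular P x" "v \<in> tangent P x" "\<rho> > 0"
  obtains \<epsilon> r where "\<And>n :: nat. \<epsilon> n > 0" "\<epsilon> \<longlonglongrightarrow> 0" "r \<longlonglongrightarrow> 0"
    "\<And>n. x + \<epsilon> n *\<^sub>R (v + r n) \<in> isotropic P \<inter> ball x \<rho>"
proof -
  \<comment> \<open>The first bound forces convergence to 0; the second, together with
    \<open>norm (r n) \<le> 1\<close>, keeps the points inside \<open>ball x \<rho>\<close>.\<close>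
  define \<delta> where "\<delta> = (\<lambda>n :: nat. min (inverse (real (Suc n))) (\<rho> / (norm v + 1)))"
  have pos: "norm v + 1 > 0" by (simp add: add_nonneg_pos)
  have \<delta>0: "\<delta> n > 0" for n using assms(4) pos by (simp add: \<delta>_def)
  have "\<exists>\<epsilon> r. 0 < \<epsilon> \<and> \<epsilon> < \<delta> n \<and> norm r \<le> \<delta> n \<and> x + \<epsilon> *\<^sub>R (v + r) \<in> isotropic P" for n
    using tangent_approx[OF assms(1-3) \<delta>0[of n]] by metis
  then obtain \<epsilon> r where er: "\<And>n. 0 < \<epsilon> n" "\<And>n. \<epsilon> n < \<delta> n" "\<And>n. norm (r n) \<le> \<delta> n"
    "\<And>n. x + \<epsilon> n *\<^sub>R (v + r n) \<in> isotropic P" by metis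
  have le: "\<delta> n \<le> inverse (real (Suc n))" for n by (simp add: \<delta>_def)
  have "norm (\<epsilon> n) \<le> inverse (real (Suc n))" for n using er(1,2)[of n] le[of n] by simp
  then have "\<epsilon> \<longlonglongrightarrow> 0"
    by (intro Lim_null_comparison[OF _ LIMSEQ_inverse_real_of_nat]) auto
  moreover have "norm (r n) \<le> inverse (real (Suc n))" for n using er(3)[of n] le[of n] by simp
  then have "r \<longlonglongrightarrow> 0"
    by (intro Lim_null_comparison[OF _ LIMSEQ_inverse_real_of_nat]) auto
  moreover have "dist x (x + \<epsilon> n *\<^sub>R (v + r n)) < \<rho>" for n
  proof -
    have "inverse (real (Suc n)) \<le> 1" by (simp add: inverse_le_1_iff)
    then have "norm (r n) \<le> 1" using er(3)[of n] le[of n] by linarith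
    then have "norm (v + r n) \<le> norm v + 1" using norm_triangle_ineq[of v "r n"] by linarith
    then have "\<epsilon> n * norm (v + r n) \<le> \<epsilon> n * (norm v + 1)" using er(1)[of n] by simp
    also have "\<dots> < \<delta> n * (norm v + 1)" using er(2)[of n] pos by simp
    also have "\<dots> \<le> \<rho>"
      using pos_le_divide_eq[OF pos, of "\<delta> n" \<rho>] by (simp add: \<delta>_def)
    finally show ?thesis using er(1)[of n] by (simp add: dist_norm)
  qed
  ultimately show thesis using that[of \<epsilon> r] er by simp
qed

text \<open>Lagrange multipliers with the second-order condition; the pair of multipliers is encoded as an
  element \<open>M\<close> of the pencil.\<close>

lemma multiplier:
  assumes x: "x \<in> isotropic P" "regular P x" and "\<rho> > 0" and "sym_matrix F"
    and vanish: "\<And>y. y \<in> isotropic P \<Longrightarrow> dist x y < \<rho> \<Longrightarrow> quad_form F y + 2 * (p \<bullet> y) = 0"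
  obtains M where "M \<in> P" "F *v x + p = M *v x" "\<And>v. v \<in> tangent P x \<Longrightarrow> quad_form (F - M) v = 0"
proof -
  let ?w = "F *v x + p"
  have expand: "2 * (?w \<bullet> u) + \<epsilon> * quad_form F u = 0"
    if "x + \<epsilon> *\<^sub>R u \<in> isotropic P \<inter> ball x \<rho>" "\<epsilon> > 0" for \<epsilon> u
  proof -
    have "quad_form F (x + \<epsilon> *\<^sub>R u) + 2 * (p \<bullet> (x + \<epsilon> *\<^sub>R u)) = 0" using vanish that by auto
    moreover have "quad_form F x + 2 * (p \<bullet> x) = 0" using vanish x \<open>\<rho> > 0\<close> by simp
    ultimately have "\<epsilon> * (2 * (?w \<bullet> u) + \<epsilon> * quad_form F u) = 0"
      by (simp add: quad_form_add[OF assms(4)] quad_form_scaleR power2_eq_square inner_add_left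
          inner_add_right algebra_simps)
    then show ?thesis using that by simp
  qed
  have first: "?w \<bullet> v = 0" if v: "v \<in> tangent P x" for v
  proof -
    obtain \<epsilon> r where er: "\<And>n :: nat. \<epsilon> n > 0" "\<epsilon> \<longlonglongrightarrow> 0" "r \<longlonglongrightarrow> 0"
      "\<And>n. x + \<epsilon> n *\<^sub>R (v + r n) \<in> isotropic P \<inter> ball x \<rho>"
      using tangent_sequence[OF x v \<open>\<rho> > 0\<close>] by blast
    have "(\<lambda>n. 2 * (?w \<bullet> (v + r n)) + \<epsilon> n * ((v + r n) \<bullet> (F *v (v + r n))))
        \<longlonglongrightarrow> 2 * (?w \<bullet> (v + 0)) + 0 * ((v + 0) \<bullet> (F *v (v + 0)))"
      by (intro tendsto_intros er bounded_linear.tendsto[OF matrix_vector_mul_bounded_linear])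
    moreover have "(\<lambda>n. 2 * (?w \<bullet> (v + r n)) + \<epsilon> n * ((v + r n) \<bullet> (F *v (v + r n)))) = (\<lambda>n. 0)"
      using expand[OF er(4) er(1)] by (simp add: quad_form_def)
    ultimately show ?thesis by (simp add: LIMSEQ_const_iff)
  qed
  \<comment> \<open>Being orthogonal to the tangent space, \<open>?w\<close> lies in the span of the
    vectors \<open>M *v x\<close>. These already form a subspace, so a single \<open>M\<close>
    serves as multiplier.\<close>
  have "?w \<in> span ((\<lambda>M. M *v x) ` P)"
    by (rule in_span_if_orthogonal) (use first in \<open>auto simp: tangent_def\<close>)
  then obtain M where M: "M \<in> P" "?w = M *v x"
    using linear_subspace_image[OF linear_matrix_vector_left subspace, of x] by (metis imageE span_eq_iff)
  \<comment> \<open>As \<open>?w = M *v x\<close>, the first-order terms of \<open>F\<close> and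
    \<open>M\<close> agree, and subtracting the two expansions shows that \<open>F - M\<close>
    vanishes exactly at \<open>v + r n\<close>, before passing to the limit.\<close>
  have "quad_form (F - M) v = 0" if v: "v \<in> tangent P x" for v
  proof -
    obtain \<epsilon> r where er: "\<And>n :: nat. \<epsilon> n > 0" "\<epsilon> \<longlonglongrightarrow> 0" "r \<longlonglongrightarrow> 0"
      "\<And>n. x + \<epsilon> n *\<^sub>R (v + r n) \<in> isotropic P \<inter> ball x \<rho>"
      using tangent_sequence[OF x v \<open>\<rho> > 0\<close>] by blast
    have "quad_form (F - M) (v + r n) = 0" for n
    proof -
      let ?u = "v + r n"
      have "quad_form M (x + \<epsilon> n *\<^sub>R ?u) = 0" "quad_form M x = 0"
        using er(4) x M(1) by (auto simp: isotropic_def)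
      then have "\<epsilon> n * (2 * ((M *v x) \<bullet> ?u) + \<epsilon> n * quad_form M ?u) = 0"
        by (simp add: quad_form_add[OF sym[OF M(1)]] quad_form_scaleR power2_eq_square algebra_simps)
      then have "2 * ((M *v x) \<bullet> ?u) + \<epsilon> n * quad_form M ?u = 0" using er(1)[of n] by simp
      moreover have "2 * ((M *v x) \<bullet> ?u) + \<epsilon> n * quad_form F ?u = 0"
        using expand[OF er(4) er(1), of n] M(2) by simp
      ultimately have "\<epsilon> n * quad_form F ?u = \<epsilon> n * quad_form M ?u" by linarith
      then show ?thesis using er(1)[of n] by (simp add: quad_form_matrix_diff)
    qed
    moreover have "(\<lambda>n. (v + r n) \<bullet> ((F - M) *v (v + r n))) \<longlonglongrightarrow> (v + 0) \<bullet> ((F - M) *v (v + 0))"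
      by (intro tendsto_intros er bounded_linear.tendsto[OF matrix_vector_mul_bounded_linear])
    ultimately show ?thesis by (simp add: quad_form_def LIMSEQ_const_iff)
  qed
  then show thesis using that M by blast
qed

lemma rank_tangent:
  assumes "sym_matrix F" "\<And>v. v \<in> tangent P x \<Longrightarrow> quad_form F v = 0"
  shows "rank F \<le> 4"
proof -
  obtain M N where MN: "M \<in> P" "M \<noteq> 0" "N \<in> P" "\<And>c. N \<noteq> c *\<^sub>R M" using ex_basis by blast
  have "rank F \<le> 2 * card {M *v x, N *v x}"
    using assms tangentI[OF MN] by (intro rank_quad_form_zero) auto
  also have "\<dots> \<le> 2 * 2" by (intro mult_le_mono) (simp_all add: card_insert_if)
  finally show ?thesis by simp
qed

lemma rank_tangent_kernel:
  fixes F :: "real ^ 'n ^ 'n"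
  assumes "\<And>v. v \<in> tangent P x \<Longrightarrow> F *v v = 0"
  shows "rank F \<le> 2"
proof -
  obtain M N where MN: "M \<in> P" "M \<noteq> 0" "N \<in> P" "\<And>c. N \<noteq> c *\<^sub>R M" using ex_basis by blast
  have "rank F \<le> card {M *v x, N *v x}"
    using assms tangentI[OF MN] by (intro rank_kernel) auto
  also have "\<dots> \<le> 2" by (simp add: card_insert_if)
  finally show ?thesis .
qed

end

section \<open>Transversal zeros, and pencils with infinitely many matrices of low rank\<close>

lemma matrix_eq_0_if_span:
  assumes "span S = UNIV" "\<And>y. y \<in> S \<Longrightarrow> F *v y = 0"
  shows "(F :: real ^ 'n ^ 'm) = 0"
proof -
  have "F *v x = 0" for x
    using linear_eq_0_on_span[OF matrix_vector_mul_linear, of S F x] assms by auto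
  then show ?thesis by (simp add: matrix_eq)
qed

lemma rank_0 [simp]: "rank (0 :: real ^ 'n ^ 'm) = 0"
  using rank_kernel[of "{}" 0] rank_le_card[of "{}" "0 :: real ^ 'n ^ 'm"] by (simp add: image_subset_iff)

text \<open>If necessary, a small shift of \<open>a0\<close> along \<open>w\<close> yields a point
  where the form is positive and \<open>w\<close> is nonzero. The line from there in direction
  \<open>b\<close> contains two zeros of the form; if \<open>w\<close> vanished at both, it would
  vanish on the whole line.\<close>

lemma ex_isotropic_transversal:
  assumes "sym_matrix F" "quad_form F a0 > 0" "quad_form F b < 0" "w \<noteq> 0"
  obtains u where "quad_form F u = 0" "w \<bullet> u \<noteq> 0" "(F *v u) \<bullet> b \<noteq> 0"
proof -
  have "\<exists>a. quad_form F a > 0 \<and> w \<bullet> a \<noteq> 0"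
  proof (cases "w \<bullet> a0 = 0")
    case True
    have "open {a. quad_form F a > 0}"
      by (intro open_Collect_less continuous_quad_form continuous_intros)
    then obtain r where r: "r > 0" "ball a0 r \<subseteq> {a. quad_form F a > 0}"
      using assms(2) by (metis mem_Collect_eq open_contains_ball)
    let ?a = "a0 + (r / 2 / norm w) *\<^sub>R w"
    have "?a \<in> ball a0 r" using r assms(4) by (simp add: dist_norm)
    moreover have "w \<bullet> ?a \<noteq> 0" using True r assms(4) by (simp add: inner_add_right)
    ultimately show ?thesis using r by blast
  qed (use assms in blast)
  then obtain a where a: "quad_form F a > 0" "w \<bullet> a \<noteq> 0" by blast
  obtain p q where pq: "p < 0" "0 < q" "quad_form F (a + p *\<^sub>R b) = 0" "quad_form F (a + q *\<^sub>R b) = 0"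
    "(F *v (a + p *\<^sub>R b)) \<bullet> b \<noteq> 0" "(F *v (a + q *\<^sub>R b)) \<bullet> b \<noteq> 0"
    using quad_form_roots[OF assms(1) a(1) assms(3)] by metis
  have "w \<bullet> (a + p *\<^sub>R b) \<noteq> 0 \<or> w \<bullet> (a + q *\<^sub>R b) \<noteq> 0"
  proof (rule ccontr)
    assume "\<not> ?thesis"
    then have "w \<bullet> a + p * (w \<bullet> b) = 0" "w \<bullet> a + q * (w \<bullet> b) = 0" by (simp_all add: inner_add_right)
    then have "(q - p) * (w \<bullet> b) = 0" unfolding left_diff_distrib by linarith
    then show False using pq a(2) \<open>w \<bullet> a + p * (w \<bullet> b) = 0\<close> by simp
  qed
  then show thesis using that pq by blast
qed

text \<open>The columns of \<open>U\<close> are preimages of three independent vectors in the range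
  of \<open>D\<close>.\<close>

lemma ex_injective_of_rank:
  fixes D :: "real ^ 'n ^ 'm"
  assumes "rank D \<ge> 3"
  obtains U :: "real ^ 3 ^ 'n" where "\<And>x. (D ** U) *v x = 0 \<Longrightarrow> x = 0"
proof -
  obtain B where B: "B \<subseteq> range ((*v) D)" "independent B" "card B = dim (range ((*v) D))"
    using basis_exists by metis
  then obtain T where T: "T \<subseteq> B" "card T = 3"
    using assms by (metis obtain_subset_with_card_n rank_dim_range)
  then obtain a b c where abc: "T = {a, b, c}" "a \<noteq> b" "a \<noteq> c" "b \<noteq> c" by (auto simp: card_3_iff)
  have indT: "independent T" using B T independent_mono by blast
  have "a \<in> range ((*v) D)" "b \<in> range ((*v) D)" "c \<in> range ((*v) D)" using abc T B by auto
  then obtain u v w where uvw: "a = D *v u" "b = D *v v" "c = D *v w" by blast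
  define U :: "real ^ 3 ^ 'n" where "U = (\<chi> i j. if j = 1 then u $ i else if j = 2 then v $ i else w $ i)"
  have U: "U *v x = x $ 1 *\<^sub>R u + x $ 2 *\<^sub>R v + x $ 3 *\<^sub>R w" for x
    by (simp add: U_def vec_eq_iff matrix_vector_mult_def sum_3)
  have "x = 0" if "(D ** U) *v x = 0" for x
  proof -
    define k where "k = (\<lambda>z. if z = a then x $ 1 else if z = b then x $ 2 else x $ 3)"
    have "x $ 1 *\<^sub>R a + x $ 2 *\<^sub>R b + x $ 3 *\<^sub>R c = 0"
      using that by (simp add: U uvw matrix_vector_right_distrib matrix_vector_mult_scaleR
          flip: matrix_vector_mul_assoc)
    then have "(\<Sum>z\<in>T. k z *\<^sub>R z) = 0" using abc by (simp add: k_def add.assoc)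
    then have "k a = 0" "k b = 0" "k c = 0" using indT abc unfolding independent_explicit by blast+
    then have "x $ 1 = 0" "x $ 2 = 0" "x $ 3 = 0" using abc by (simp_all add: k_def)
    then show ?thesis by (simp add: vec_eq_iff forall_3)
  qed
  then show thesis using that by blast
qed

text \<open>The determinant of a \<open>3 \<times> 3\<close> compression of \<open>t C - D\<close> is a polynomial in \<open>t\<close> with infinitely
  many zeros \<open>t = 1 / s\<close>, so it also vanishes at \<open>t = 0\<close>.\<close>

lemma rank_le_2_if_infinite:
  fixes C D :: "real ^ 'n ^ 'm"
  assumes "infinite S" and "\<And>s. s \<in> S \<Longrightarrow> rank (C - s *\<^sub>R D) \<le> 2"
  shows "rank D \<le> 2"
proof (rule ccontr)
  assume "\<not> ?thesis"
  then obtain U :: "real ^ 3 ^ 'n" where U: "\<And>x. (D ** U) *v x = 0 \<Longrightarrow> x = 0"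
    using ex_injective_of_rank[of D] by (metis Suc_leI not_le numeral_2_eq_2 numeral_3_eq_3)
  define A where "A = D ** U"
  \<comment> \<open>\<open>L\<close> is the Gram matrix of the injective matrix \<open>A\<close>,
    hence nonsingular, whereas \<open>K - s *\<^sub>R L\<close> is a compression of
    \<open>C - s *\<^sub>R D\<close> and is singular for every \<open>s\<close> in
    \<open>S\<close>.\<close>
  define K L where "K = transpose A ** C ** U" and "L = transpose A ** A"
  define p where "p = det (\<chi> i j. [:- (L $ i $ j), K $ i $ j:])"
  have poly_p: "poly p t = det (t *\<^sub>R K - L)" for t
    by (simp add: p_def det_3 algebra_simps)
  have zero: "poly p (1 / s) = 0" if "s \<in> S - {0}" for s
  proof -
    have "(1 / s) *\<^sub>R K - L = (1 / s) *\<^sub>R (transpose A ** (C - s *\<^sub>R D) ** U)"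
    proof -
      have "transpose A ** (C - s *\<^sub>R D) ** U = K - s *\<^sub>R L"
        by (simp add: matrix_eq K_def L_def A_def matrix_vector_mult_diff_rdistrib matrix_vector_mult_diff_distrib
            matrix_vector_mult_scaleR flip: matrix_vector_mul_assoc scaleR_matrix_vector_assoc)
      then show ?thesis using that by (simp add: scaleR_diff_right)
    qed
    moreover have "rank ((1 / s) *\<^sub>R (transpose A ** (C - s *\<^sub>R D) ** U)) \<le> 2"
    proof -
      have "rank ((1 / s) *\<^sub>R (transpose A ** (C - s *\<^sub>R D) ** U)) \<le> rank (transpose A ** (C - s *\<^sub>R D) ** U)"
        by (rule rank_scaleR_le)
      also have "\<dots> \<le> rank (transpose A ** (C - s *\<^sub>R D))" by (rule rank_mul_le_left)
      also have "\<dots> \<le> rank (C - s *\<^sub>R D)" by (rule rank_mul_le_right)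
      also have "\<dots> \<le> 2" using assms(2) that by blast
      finally show ?thesis .
    qed
    ultimately show ?thesis by (simp add: poly_p det_eq_0_rank)
  qed
  have "infinite ((\<lambda>s. 1 / s) ` (S - {0}))"
    using assms(1) by (subst finite_image_iff) (auto simp: inj_on_def)
  moreover have "(\<lambda>s. 1 / s) ` (S - {0}) \<subseteq> {t. poly p t = 0}" using zero by auto
  ultimately have "p = 0" using poly_roots_finite finite_subset by blast
  then have "det (- L) = 0" using poly_p[of 0] by simp
  then have "\<not> invertible (- L)" by (simp add: invertible_det_nz)
  then obtain x where x: "(- L) *v x = 0" "x \<noteq> 0"
    by (metis invertible_left_inverse matrix_left_invertible_ker)
  have "L *v x = 0" using x(1) matrix_vector_mult_diff_rdistrib[of 0 L x] by simp
  then have "(A *v x) \<bullet> (A *v x) = 0"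
    by (metis L_def dot_lmul_matrix inner_zero_right matrix_vector_mul_assoc transpose_matrix_vector inner_commute)
  then show False using U x(2) by (simp add: A_def)
qed

section \<open>Existence of regular isotropic points\<close>

context pencil
begin

text \<open>If \<open>D\<close> were nonpositive at all zeros of \<open>E\<close>, Finsler's lemma
  would make some \<open>D + t *\<^sub>R E\<close> negative semidefinite, against
  \<open>nd\<close>.\<close>

lemma separate:
  assumes nd: "\<And>M. M \<in> P \<Longrightarrow> M \<noteq> 0 \<Longrightarrow> \<exists>x. quad_form M x > 0"
    and "E \<in> P" "E \<noteq> 0" "D \<in> P" "\<And>c. D \<noteq> c *\<^sub>R E"
  obtains x where "quad_form E x = 0" "quad_form D x > 0"
proof (rule ccontr)
  assume "\<not> thesis"
  then have "\<not> quad_form D x > 0" if "quad_form E x = 0" for x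
    using \<open>\<And>x. quad_form E x = 0 \<Longrightarrow> quad_form D x > 0 \<Longrightarrow> thesis\<close> that by blast
  then have le: "quad_form (- D) x \<ge> 0" if "quad_form E x = 0" for x
    using that by (simp add: quad_form_matrix_uminus not_less)
  obtain x0 where x0: "quad_form E x0 > 0" using nd assms by blast
  have "\<exists>y. quad_form (- E) y > 0" using assms(2,3) subspace_neg[OF subspace] by (intro nd) auto
  then obtain y0 where "quad_form (- E) y0 > 0" by blast
  then have y0: "quad_form E y0 < 0" by (simp add: quad_form_matrix_uminus)
  obtain t where t: "\<And>x. quad_form (- D) x \<ge> t * quad_form E x"
    using finsler[OF sym_matrix_uminus[OF sym[OF assms(4)]] sym[OF assms(2)] subspace_UNIV UNIV_I x0 UNIV_I y0] le
    by (metis UNIV_I)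
  have "D + t *\<^sub>R E \<in> P" using assms subspace by (simp add: subspace_add subspace_scale)
  moreover have "D + t *\<^sub>R E \<noteq> 0" using assms(5)[of "-t"] by (metis add_eq_0_iff2 scaleR_minus_left)
  ultimately obtain x where "quad_form (D + t *\<^sub>R E) x > 0" using nd by blast
  then show False using t[of x]
    by (simp add: quad_form_matrix_add quad_form_matrix_scaleR quad_form_matrix_uminus)
qed

text \<open>The zero set of \<open>E\<close> contains points \<open>x\<close> and \<open>y\<close>
  where \<open>D\<close> has opposite signs. A line or curve inside this set meets a zero of
  \<open>D\<close>, and pairing with \<open>y\<close> or \<open>x\<close> shows that this zero is
  outside the joint radical. The rank bound supplies the extra direction \<open>e\<close> that bends
  the curve into the zero set.\<close>

lemma ex_isotropic_nonradical:
  assumes nd: "\<And>M. M \<in> P \<Longrightarrow> M \<noteq> 0 \<Longrightarrow> \<exists>x. quad_form M x > 0"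
    and "E \<in> P" "rank E \<ge> 5"
  obtains z M where "z \<in> isotropic P" "M \<in> P" "M *v z \<noteq> 0"
proof -
  note symE = sym[OF assms(2)]
  have E0: "E \<noteq> 0" using assms(3) by auto
  obtain D where D: "D \<in> P" "\<And>c. D \<noteq> c *\<^sub>R E" using ex_nonmultiple by blast
  note symD = sym[OF D(1)]
  obtain x where x: "quad_form E x = 0" "quad_form D x > 0" using separate[OF nd assms(2) E0 D] by blast
  have "- D \<in> P" "- D \<noteq> c *\<^sub>R E" for c
    using D(1) subspace_neg[OF subspace] D(2)[of "-c"] by (simp, metis minus_equation_iff scaleR_minus_left)
  then obtain y where "quad_form E y = 0" "quad_form (- D) y > 0"
    using separate[OF nd assms(2) E0, of "- D"] by metis
  then have y: "quad_form E y = 0" "quad_form D y < 0" by (simp_all add: quad_form_matrix_uminus)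
  note iso = isotropicI[OF assms(2) E0 D]
  show thesis
  proof (cases "(E *v x) \<bullet> y = 0")
    case True
    obtain p where p: "quad_form D (x + p *\<^sub>R y) = 0" "(D *v (x + p *\<^sub>R y)) \<bullet> y \<noteq> 0"
      using quad_form_roots[OF symD x(2) y(2)] by metis
    have "quad_form E (x + p *\<^sub>R y) = 0"
      using True x y by (simp add: quad_form_add[OF symE] quad_form_scaleR)
    then show thesis using that[OF iso D(1)] p by fastforce
  next
    case False
    obtain e where e: "quad_form E e \<noteq> 0" "(E *v x) \<bullet> e = 0" "(E *v y) \<bullet> e = 0"
    proof (rule ccontr)
      assume "\<not> thesis"
      then have "rank E \<le> 2 * card {E *v x, E *v y}"
        using that by (intro rank_quad_form_zero symE) auto
      also have "\<dots> \<le> 2 * 2" by (intro mult_le_mono) (simp_all add: card_insert_if)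
      finally show False using assms(3) by simp
    qed
    \<comment> \<open>Replacing \<open>y\<close> by \<open>- y\<close> changes neither quadratic
      form but flips the mixed term, so the number under the square root below can be made
      nonnegative.\<close>
    obtain y' where y': "quad_form E y' = 0" "quad_form D y' < 0" "(E *v y') \<bullet> e = 0"
      "- ((E *v x) \<bullet> y') / quad_form E e > 0"
    proof (cases "- ((E *v x) \<bullet> y) / quad_form E e > 0")
      case False
      then have "- ((E *v x) \<bullet> (- y)) / quad_form E e > 0"
        using e \<open>(E *v x) \<bullet> y \<noteq> 0\<close> by (auto simp: divide_less_0_iff zero_less_divide_iff not_less le_less)
      moreover have "(E *v (- y)) \<bullet> e = 0" using e(3) by (metis inner_minus_left linear_neg[OF matrix_vector_mul_linear] neg_equal_0_iff_equal)
      ultimately show ?thesis using that[of "- y"] y quad_form_scaleR[of _ "-1" y] by simp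
    qed (use y e that in blast)
    define \<kappa> c where "\<kappa> = - ((E *v x) \<bullet> y') / quad_form E e" and "c = (E *v x) \<bullet> y'"
    have \<kappa>: "\<kappa> > 0" "\<kappa> * quad_form E e = - c" "c \<noteq> 0" using y' e by (auto simp: \<kappa>_def c_def)
    \<comment> \<open>The component along \<open>e\<close> compensates the mixed term of
      \<open>x\<close> and \<open>y'\<close>, so that \<open>E\<close> vanishes along the whole
      curve from \<open>x\<close> to \<open>y'\<close>.\<close>
    define z where "z = (\<lambda>\<tau>. (1 - \<tau>) *\<^sub>R x + \<tau> *\<^sub>R y' + sqrt (2 * \<tau> * (1 - \<tau>) * \<kappa>) *\<^sub>R e)"
    have Ez: "quad_form E (z \<tau>) = 0" if "0 \<le> \<tau>" "\<tau> \<le> 1" for \<tau>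
    proof -
      have "quad_form E (a *\<^sub>R x + b *\<^sub>R y' + s *\<^sub>R e) = 2 * a * b * c + s\<^sup>2 * quad_form E e" for a b s
        using x y' e by (simp add: c_def quad_form_add[OF symE] quad_form_scaleR matrix_vector_right_distrib
            matrix_vector_mult_scaleR inner_add_left)
      moreover have "(sqrt (2 * \<tau> * (1 - \<tau>) * \<kappa>))\<^sup>2 = 2 * \<tau> * (1 - \<tau>) * \<kappa>" using that \<kappa> by simp
      ultimately have "quad_form E (z \<tau>) = 2 * (1 - \<tau>) * \<tau> * c + 2 * \<tau> * (1 - \<tau>) * \<kappa> * quad_form E e"
        unfolding z_def by simp
      also have "\<dots> = 2 * \<tau> * (1 - \<tau>) * (c + \<kappa> * quad_form E e)" by (simp add: algebra_simps)
      finally have "quad_form E (z \<tau>) = 2 * \<tau> * (1 - \<tau>) * (c + \<kappa> * quad_form E e)" .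
      then show ?thesis using \<kappa> by simp
    qed
    have "continuous_on {0..1} (\<lambda>\<tau>. quad_form D (z \<tau>))"
      unfolding z_def by (intro continuous_on_compose2[OF continuous_quad_form[of UNIV]] continuous_intros) auto
    moreover have z01: "quad_form D (z 0) > 0" "quad_form D (z 1) < 0" using x y' by (simp_all add: z_def)
    ultimately obtain \<tau> where \<tau>: "0 \<le> \<tau>" "\<tau> \<le> 1" "quad_form D (z \<tau>) = 0"
      using IVT2'[of "\<lambda>\<tau>. quad_form D (z \<tau>)" 1 0 0] by auto
    then have "\<tau> \<noteq> 0" using z01 by auto
    have "(E *v z \<tau>) \<bullet> x = (E *v x) \<bullet> z \<tau>"
      by (metis inner_commute sym_matrix_inner[OF symE])
    also have "\<dots> = \<tau> * c"
      using x e by (simp add: z_def c_def quad_form_def inner_add_right inner_commute[of x])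
    finally have "E *v z \<tau> \<noteq> 0" using \<open>\<tau> \<noteq> 0\<close> \<kappa>(3) by force
    then show thesis using that[OF iso assms(2)] Ez \<tau> by blast
  qed
qed

text \<open>If some nonzero \<open>D\<close> in \<open>P\<close> kills \<open>z\<close>, adding a
  multiple of \<open>z\<close> to a zero \<open>u\<close> of \<open>D\<close> leaves
  \<open>D\<close> zero, and the value of \<open>M\<close> is affine in the multiple, so it can be
  made zero. The minor in the directions \<open>b\<close> and \<open>z\<close> is then triangular
  with nonzero diagonal.\<close>

lemma ex_regular:
  assumes nd: "\<And>M. M \<in> P \<Longrightarrow> M \<noteq> 0 \<Longrightarrow> \<exists>x. quad_form M x > 0"
    and "E \<in> P" "rank E \<ge> 5"
  obtains x where "x \<in> isotropic P" "regular P x"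
proof -
  obtain z M where z: "z \<in> isotropic P" and M: "M \<in> P" "M *v z \<noteq> 0"
    using ex_isotropic_nonradical[OF assms] by metis
  show thesis
  proof (cases "regular P z")
    case False
    then obtain D where D: "D \<in> P" "D \<noteq> 0" "D *v z = 0" by (auto simp: regular_def)
    have mult: "M \<noteq> c *\<^sub>R D" for c
      using M(2) D(3) by (auto simp flip: scaleR_matrix_vector_assoc)
    obtain a where "quad_form D a > 0" using nd D by blast
    moreover obtain b where "quad_form D b < 0"
      using nd[of "- D"] D subspace_neg[OF subspace] by (auto simp: quad_form_matrix_uminus)
    ultimately obtain u where u: "quad_form D u = 0" "(M *v z) \<bullet> u \<noteq> 0" "(D *v u) \<bullet> b \<noteq> 0"
      using ex_isotropic_transversal[OF sym[OF D(1)] _ _ M(2)] by metis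
    define c where "c = - quad_form M u / (2 * ((M *v z) \<bullet> u))"
    have Muz: "(M *v u) \<bullet> z = (M *v z) \<bullet> u"
      by (metis inner_commute sym_matrix_inner[OF sym[OF M(1)]])
    have Du: "(D *v u) \<bullet> z = 0"
      using sym_matrix_inner[OF sym[OF D(1)], of u z] D(3) by simp
    have Mz: "quad_form M z = 0" using z M by (simp add: isotropic_def)
    let ?x = "u + c *\<^sub>R z"
    have "quad_form D ?x = 0"
      using u D(3) Du by (simp add: quad_form_add[OF sym[OF D(1)]] quad_form_scaleR quad_form_def[of D z])
    moreover have "quad_form M ?x = 0"
    proof -
      have "quad_form M ?x = quad_form M u + 2 * (c * ((M *v z) \<bullet> u))"
        using Mz Muz by (simp add: quad_form_add[OF sym[OF M(1)]] quad_form_scaleR)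
      then show ?thesis using u(2) by (simp add: c_def)
    qed
    ultimately have "?x \<in> isotropic P" using isotropicI[OF D(1,2) M(1) mult] by blast
    moreover have "regular P ?x"
    proof (rule regularI[OF D(1,2) M(1) mult, where e = b and f = z])
      have "(D *v ?x) \<bullet> b \<noteq> 0" "(D *v ?x) \<bullet> z = 0" "(M *v ?x) \<bullet> z \<noteq> 0"
        using u Du D(3) Mz Muz
        by (simp_all add: matrix_vector_right_distrib matrix_vector_mult_scaleR inner_add_left
            quad_form_def inner_commute[of z])
      then show "(D *v ?x) \<bullet> b * ((M *v ?x) \<bullet> z) - (D *v ?x) \<bullet> z * ((M *v ?x) \<bullet> b) \<noteq> 0" by simp
    qed
    ultimately show thesis using that by blast
  qed (use that z in blast)
qed

text \<open>A linear form \<open>l\<close> that vanishes on the isotropic points near \<open>x\<close> is itself of the form \<open>D y\<close>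
  with \<open>rank D \<le> 4\<close> at every such point \<open>y\<close>, hence for one and the same \<open>D\<close> up to a factor; this
  \<open>D\<close> then maps the span of these points into the line of \<open>l\<close>, which forces \<open>rank D \<le> 2\<close>.\<close>

lemma span_isotropic_ball:
  assumes minrank: "\<And>M. M \<in> P \<Longrightarrow> M \<noteq> 0 \<Longrightarrow> rank M \<ge> 3"
    and E: "E \<in> P" "rank E \<ge> 9"
    and x: "x \<in> isotropic P" "regular P x" and "\<rho> > 0"
  shows "span (isotropic P \<inter> ball x \<rho>) = UNIV"
proof (rule ccontr)
  assume nspan: "span (isotropic P \<inter> ball x \<rho>) \<noteq> UNIV"
  obtain \<rho>1 where \<rho>1: "\<rho>1 > 0" "\<And>y. dist x y < \<rho>1 \<Longrightarrow> regular P y" using regular_open[OF x(2)] by blast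
  define r where "r = min \<rho> \<rho>1"
  define V where "V = isotropic P \<inter> ball x r"
  have r: "r > 0" "r \<le> \<rho>" "r \<le> \<rho>1" using \<rho>1 \<open>\<rho> > 0\<close> by (auto simp: r_def)
  have xV: "x \<in> V" using x r by (simp add: V_def)
  have "span V \<subseteq> span (isotropic P \<inter> ball x \<rho>)" using r by (intro span_mono) (auto simp: V_def)
  then have "span V \<noteq> UNIV" using nspan by auto
  then obtain l where l: "l \<noteq> 0" "\<And>y. y \<in> V \<Longrightarrow> l \<bullet> y = 0"
  proof -
    obtain w where w: "w \<notin> span V" using \<open>span V \<noteq> UNIV\<close> by auto
    obtain v where "\<And>a. a \<in> V \<Longrightarrow> a \<bullet> v = 0" "w \<bullet> v \<noteq> 0" using in_span_if_orthogonal[of V w] w by blast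
    then show thesis using that[of v] by (force simp: inner_commute)
  qed
  \<comment> \<open>\<open>multiplier\<close> with zero quadratic part and linear part
    \<open>m\<close> gives \<open>m = D *v y\<close>; its second-order condition makes
    \<open>D\<close> vanish on the tangent space.\<close>
  have form: "\<exists>D\<in>P. D \<noteq> 0 \<and> rank D \<le> 4 \<and> m = D *v y" if m: "m \<noteq> 0" "\<And>y. y \<in> V \<Longrightarrow> m \<bullet> y = 0" and y: "y \<in> V" for m y
  proof -
    have "dist x y < r" "y \<in> isotropic P" using y by (auto simp: V_def)
    then have "y \<in> isotropic P" "regular P y" using \<rho>1 r by auto
    moreover have "r - dist x y > 0" using \<open>dist x y < r\<close> by simp
    moreover have "quad_form 0 z + 2 * (m \<bullet> z) = 0"
      if "z \<in> isotropic P" "dist y z < r - dist x y" for z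
    proof -
      have "dist x z < r" using dist_triangle[of x z y] that by simp
      then show ?thesis using m(2)[of z] that by (simp add: V_def quad_form_def)
    qed
    ultimately obtain D where D: "D \<in> P" "0 *v y + m = D *v y" "\<And>v. v \<in> tangent P y \<Longrightarrow> quad_form (0 - D) v = 0"
      using multiplier[of y "r - dist x y" 0 m] by (metis sym_matrix_diff sym[OF E(1)] diff_self)
    have "quad_form D v = 0" if "v \<in> tangent P y" for v
      using D(3)[OF that] by (simp add: quad_form_matrix_uminus)
    then have "rank D \<le> 4" using rank_tangent[OF sym[OF D(1)]] by blast
    moreover have "m = D *v y" using D(2) by simp
    ultimately show ?thesis using D(1) m(1) by (metis matrix_vector_mult_0)
  qed
  obtain D where D: "D \<in> P" "D \<noteq> 0" "rank D \<le> 4" using form[OF l xV] by blast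
  have in_line: "D *v s \<in> span {m}" if m: "m \<noteq> 0" "\<And>y. y \<in> V \<Longrightarrow> m \<bullet> y = 0" and s: "s \<in> span V" for m s
  proof -
    have "D *v y \<in> span {m}" if "y \<in> V" for y
    proof -
      obtain D' where D': "D' \<in> P" "D' \<noteq> 0" "rank D' \<le> 4" "m = D' *v y" using form[OF m \<open>y \<in> V\<close>] by blast
      then obtain c where "D = c *\<^sub>R D'"
        using low_rank_multiple[OF D'(1,2) D(1) D'(3) D(3) E(1)] E(2) by auto
      then show ?thesis using D'(4) by (auto simp: span_singleton simp flip: scaleR_matrix_vector_assoc)
    qed
    then have "(*v) D ` V \<subseteq> span {m}" by blast
    then have "span ((*v) D ` V) \<subseteq> span {m}" by (simp add: span_minimal)
    then show ?thesis using s linear_span_image[OF matrix_vector_mul_linear, of D V] by blast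
  qed
  \<comment> \<open>Tangent vectors are limits of difference quotients of points of
    \<open>V\<close>, and \<open>span V\<close> is closed.\<close>
  have tangent: "v \<in> span V" if v: "v \<in> tangent P x" for v
  proof -
    obtain \<epsilon> w where er: "\<And>n :: nat. \<epsilon> n > 0" "\<epsilon> \<longlonglongrightarrow> 0" "w \<longlonglongrightarrow> 0"
      "\<And>n. x + \<epsilon> n *\<^sub>R (v + w n) \<in> isotropic P \<inter> ball x r"
      using tangent_sequence[OF x v r(1)] by blast
    have "v + w n \<in> span V" for n
    proof -
      have "(x + \<epsilon> n *\<^sub>R (v + w n)) - x \<in> span V"
        using er(4) xV by (intro span_diff span_base) (auto simp: V_def)
      from span_scale[OF this, of "1 / \<epsilon> n"] show ?thesis using er(1)[of n] by simp
    qed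
    moreover have "(\<lambda>n. v + w n) \<longlonglongrightarrow> v + 0" by (intro tendsto_intros er)
    ultimately show ?thesis using closed_sequentially[OF closed_span] by fastforce
  qed
  \<comment> \<open>If a form independent of \<open>l\<close> also vanishes on \<open>V\<close>,
    then \<open>D\<close> maps \<open>span V\<close> into two different lines, hence to 0, and so
    kills the tangent space. Otherwise \<open>span V\<close> contains the hyperplane
    \<open>l = 0\<close>, which \<open>D\<close> maps into the line of \<open>l\<close>; the
    quadratic form of \<open>D\<close> vanishes on it.\<close>
  have "rank D \<le> 2"
  proof (cases "\<exists>m. m \<notin> span {l} \<and> (\<forall>y\<in>V. m \<bullet> y = 0)")
    case True
    then obtain m where m: "m \<notin> span {l}" "\<And>y. y \<in> V \<Longrightarrow> m \<bullet> y = 0" by blast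
    then have "m \<noteq> 0" using span_zero by blast
    have "D *v s = 0" if s: "s \<in> span V" for s
    proof -
      obtain j k where jk: "D *v s = j *\<^sub>R l" "D *v s = k *\<^sub>R m"
        using in_line[OF l s] in_line[OF \<open>m \<noteq> 0\<close> m(2) s] by (auto simp: span_singleton)
      have "k = 0"
      proof (rule ccontr)
        assume "k \<noteq> 0"
        then have "m = (1 / k) *\<^sub>R (D *v s)" using jk(2) by simp
        then have "m = (j / k) *\<^sub>R l" using jk(1) by simp
        then show False using m(1) by (auto simp: span_singleton)
      qed
      then show ?thesis using jk by simp
    qed
    then show ?thesis using rank_tangent_kernel tangent by blast
  next
    case False
    have "v \<in> span V" if "l \<bullet> v = 0" for v
    proof (rule in_span_if_orthogonal)
      fix m assume "\<And>a. a \<in> V \<Longrightarrow> a \<bullet> m = 0"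
      then have "m \<in> span {l}" using False by (metis inner_commute)
      then show "v \<bullet> m = 0" using that by (auto simp: span_singleton inner_commute)
    qed
    then have "quad_form D v = 0" if "l \<bullet> v = 0" for v
      using in_line[OF l, of v] that by (auto simp: span_singleton quad_form_def inner_commute)
    then have "rank D \<le> 2 * card {l}" by (intro rank_quad_form_zero sym D) auto
    then show ?thesis by simp
  qed
  then show False using minrank[OF D(1,2)] by simp
qed

section \<open>Condition (i): forms vanishing on the isotropic set\<close>

lemma vanishing_in_pencil:
  assumes nd: "\<And>M. M \<in> P \<Longrightarrow> M \<noteq> 0 \<Longrightarrow> \<exists>x. quad_form M x > 0"
    and minrank: "\<And>M. M \<in> P \<Longrightarrow> M \<noteq> 0 \<Longrightarrow> rank M \<ge> 3"
    and E: "E \<in> P" "rank E \<ge> 17"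
    and symC: "sym_matrix C" and vanish: "\<And>y. y \<in> isotropic P \<Longrightarrow> quad_form C y = 0"
  shows "C \<in> P"
proof -
  have "rank E \<ge> 5" using E(2) by simp
  then obtain x0 where x0: "x0 \<in> isotropic P" "regular P x0" using ex_regular[OF nd E(1)] by blast
  obtain \<rho> where \<rho>: "\<rho> > 0" "\<And>y. dist x0 y < \<rho> \<Longrightarrow> regular P y" using regular_open[OF x0(2)] by blast
  define V where "V = isotropic P \<inter> ball x0 \<rho>"
  have VD: "y \<in> isotropic P" "regular P y" if "y \<in> V" for y using that \<rho> by (auto simp: V_def)
  have "\<forall>y\<in>V. \<exists>M. M \<in> P \<and> C *v y = M *v y \<and> (\<forall>v\<in>tangent P y. quad_form (C - M) v = 0)"
  proof
    fix y assume "y \<in> V"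
    then obtain M where "M \<in> P" "C *v y + 0 = M *v y" "\<And>v. v \<in> tangent P y \<Longrightarrow> quad_form (C - M) v = 0"
      using multiplier[of y 1 C 0] VD symC vanish by (metis add_0_right inner_zero_left mult_zero_right zero_less_one)
    then show "\<exists>M. M \<in> P \<and> C *v y = M *v y \<and> (\<forall>v\<in>tangent P y. quad_form (C - M) v = 0)" by auto
  qed
  then obtain m where m: "\<And>y. y \<in> V \<Longrightarrow> m y \<in> P" "\<And>y. y \<in> V \<Longrightarrow> C *v y = m y *v y"
    "\<And>y v. y \<in> V \<Longrightarrow> v \<in> tangent P y \<Longrightarrow> quad_form (C - m y) v = 0" by metis
  have x0V: "x0 \<in> V" using x0 \<rho> by (simp add: V_def)
  have sym_diff: "sym_matrix (C - m y)" if "y \<in> V" for y using symC sym m(1) that by (simp add: sym_matrix_diff)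
  have rank4: "rank (C - m y) \<le> 4" if "y \<in> V" for y using rank_tangent sym_diff m(3) that by blast
  have span_V: "span (isotropic P \<inter> ball y r) = UNIV" if "y \<in> V" "r > 0" for y r
    using span_isotropic_ball[OF minrank E(1) _ VD] that E(2) by simp
  \<comment> \<open>Subtracting the multiplier at \<open>x0\<close> does not affect membership in
    \<open>P\<close> and produces a matrix of rank at most 4.\<close>
  define C0 where "C0 = C - m x0"
  have symC0: "sym_matrix C0" using sym_diff x0V by (simp add: C0_def)
  have C0P: "C \<in> P" if "C0 \<in> P"
    using that subspace_add[OF subspace that m(1)[OF x0V]] by (simp add: C0_def)
  show ?thesis
  proof (cases "\<forall>y\<in>V. C0 *v y = 0")
    case True
    then have "C0 = 0" using matrix_eq_0_if_span[OF span_V[OF x0V \<rho>(1)], of C0] by (simp add: V_def)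
    then show ?thesis using C0P subspace_0[OF subspace] by simp
  next
    case False
    then obtain y1 where y1: "y1 \<in> V" "C0 *v y1 \<noteq> 0" by blast
    define D where "D = m y1 - m x0"
    have D: "D \<in> P" using m(1) y1 x0V subspace by (simp add: D_def subspace_diff)
    have "C0 *v y1 = D *v y1" using m(2)[OF y1(1)] by (simp add: C0_def D_def matrix_vector_mult_diff_rdistrib)
    then have D0: "D \<noteq> 0" using y1(2) by auto
    have rank8: "rank (m y - m x0) \<le> 8" if "y \<in> V" for y
      using rank_diff_le[of "C - m x0" "C - m y"] rank4[OF that] rank4[OF x0V] by simp
    have "\<exists>c. m y - m x0 = c *\<^sub>R D" if "y \<in> V" for y
    proof -
      have "m y - m x0 \<in> P" using m(1) that x0V subspace by (simp add: subspace_diff)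
      then show ?thesis
        using low_rank_multiple[OF D D0 _ _ rank8[OF that] E(1)] rank8[OF y1(1)] E(2) by (auto simp: D_def)
    qed
    then obtain s where s: "\<And>y. y \<in> V \<Longrightarrow> m y - m x0 = s y *\<^sub>R D" by metis
    have C0s: "C - m y = C0 - s y *\<^sub>R D" if "y \<in> V" for y by (simp add: C0_def flip: s[OF that])
    have ker: "(C0 - s y *\<^sub>R D) *v y = 0" if "y \<in> V" for y
      using m(2)[OF that] by (simp add: matrix_vector_mult_diff_rdistrib flip: C0s[OF that])
    \<comment> \<open>Such a \<open>k\<close> exists because \<open>rank C0 + rank D\<close> is at
      most 4 + 8, less than 17.\<close>
    obtain k where k: "C0 *v k = 0" "D *v k = 0" "E *v k \<noteq> 0"
    proof (rule ccontr)
      assume "\<not> thesis"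
      then have "rank E \<le> rank C0 + rank D"
        using that by (intro rank_le_if_kernel_Int sym E D symC0) blast
      then show False using rank4[OF x0V] rank8[OF y1(1)] E(2) by (simp add: C0_def D_def)
    qed
    have ED: "E \<noteq> c *\<^sub>R D" for c using k by (auto simp flip: scaleR_matrix_vector_assoc)
    obtain z where z: "z \<in> V" "(E *v k) \<bullet> z \<noteq> 0"
    proof (rule ccontr)
      assume "\<not> thesis"
      then have "(E *v k) \<bullet> y = 0" if y: "y \<in> V" for y using y \<open>\<And>z. z \<in> V \<Longrightarrow> (E *v k) \<bullet> z \<noteq> 0 \<Longrightarrow> thesis\<close> by blast
      then have "(E *v k) \<bullet> y = 0" if "y \<in> span V" for y
        using that orthogonal_to_span[of y V "E *v k"] by (simp add: orthogonal_def)
      then have "(E *v k) \<bullet> (E *v k) = 0" using span_V[OF x0V \<rho>(1)] by (simp add: V_def)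
      then show False using k by simp
    qed
    \<comment> \<open>A vector \<open>x\<close> orthogonal to \<open>D *v y\<close> can be moved
      along \<open>k\<close> into the tangent space, since \<open>k\<close> is transversal to
      \<open>E *v y\<close>. As \<open>?F\<close> kills \<open>k\<close>, its quadratic form is
      unchanged, so it vanishes on all of the hyperplane.\<close>
    have rank2: "rank (C0 - s y *\<^sub>R D) \<le> 2" if y: "y \<in> V" "(E *v k) \<bullet> y \<noteq> 0" for y
    proof -
      let ?F = "C0 - s y *\<^sub>R D"
      have symF: "sym_matrix ?F" using sym_diff[OF y(1)] by (simp add: C0s[OF y(1)])
      have Eyk: "(E *v y) \<bullet> k = (E *v k) \<bullet> y"
        by (metis inner_commute sym_matrix_inner[OF sym[OF E(1)]])
      have "quad_form ?F x = 0" if "(D *v y) \<bullet> x = 0" for x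
      proof -
        define c where "c = ((E *v y) \<bullet> x) / ((E *v y) \<bullet> k)"
        have "(D *v y) \<bullet> k = 0" using k(2) sym_matrix_inner[OF sym[OF D], of y k] by simp
        then have "x - c *\<^sub>R k \<in> tangent P y"
          using that y(2) by (intro tangentI[OF D D0 E(1) ED]) (auto simp: inner_diff_right c_def Eyk)
        then have "quad_form ?F (x - c *\<^sub>R k) = 0" using m(3)[OF y(1)] by (simp add: C0s[OF y(1)])
        moreover have "?F *v (c *\<^sub>R k) = 0"
          using k by (simp add: matrix_vector_mult_diff_rdistrib matrix_vector_mult_scaleR flip: scaleR_matrix_vector_assoc)
        moreover have "(?F *v (x - c *\<^sub>R k)) \<bullet> (c *\<^sub>R k) = 0"
          using calculation(2) sym_matrix_inner[OF symF, of "x - c *\<^sub>R k" "c *\<^sub>R k"] by simp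
        ultimately show ?thesis
          using quad_form_add[OF symF, of "x - c *\<^sub>R k" "c *\<^sub>R k"] by (simp add: quad_form_def[of _ "c *\<^sub>R k"])
      qed
      then have "rank ?F \<le> 2 * card {D *v y}" by (intro rank_quad_form_zero symF) auto
      then show ?thesis by simp
    qed
    define S where "S = {t. rank (C0 - t *\<^sub>R D) \<le> 2}"
    have "finite S"
    proof (rule ccontr)
      assume "infinite S"
      then have "rank D \<le> 2" by (rule rank_le_2_if_infinite) (simp add: S_def)
      then show False using minrank[OF D D0] by simp
    qed
    have Dz: "D *v z \<noteq> 0" using VD(2)[OF z(1)] D D0 by (auto simp: regular_def)
    \<comment> \<open>On this neighbourhood of \<open>z\<close> every value of the finite set
      \<open>S\<close> other than \<open>s z\<close> is excluded, because
      \<open>C0 - s y *\<^sub>R D\<close> has to kill \<open>y\<close>.\<close>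
    define U where "U = ball x0 \<rho> \<inter> {y. (E *v k) \<bullet> y \<noteq> 0} \<inter> (\<Inter>t\<in>S - {s z}. {y. (C0 - t *\<^sub>R D) *v y \<noteq> 0})"
    have "open {y. F *v y \<noteq> 0}" for F :: "real ^ 'n ^ 'n"
      by (intro open_Collect_neq matrix_vector_mult_linear_continuous_on continuous_on_const)
    then have "open U"
      unfolding U_def using \<open>finite S\<close>
      by (intro open_Int open_INT open_ball open_Collect_neq continuous_intros) auto
    moreover have "z \<in> U"
    proof -
      have "(C0 - t *\<^sub>R D) *v z \<noteq> 0" if "t \<noteq> s z" for t
      proof -
        have "(C0 - t *\<^sub>R D) *v z = (s z - t) *\<^sub>R (D *v z)"
          using ker[OF z(1)]
          by (simp add: matrix_vector_mult_diff_rdistrib scaleR_diff_left flip: scaleR_matrix_vector_assoc)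
        then show ?thesis using that Dz by simp
      qed
      then show ?thesis using z by (auto simp: U_def V_def)
    qed
    ultimately obtain r where r: "r > 0" "ball z r \<subseteq> U" by (meson open_contains_ball)
    have "(C0 - s z *\<^sub>R D) *v y = 0" if "y \<in> isotropic P \<inter> ball z r" for y
    proof -
      have y: "y \<in> V" "y \<in> U" using that r by (auto simp: V_def U_def)
      then have "s y \<in> S" using rank2 by (auto simp: S_def U_def)
      then have "s y = s z" using ker[OF y(1)] y(2) by (auto simp: U_def)
      then show ?thesis using ker[OF y(1)] by simp
    qed
    then have "C0 - s z *\<^sub>R D = 0" by (rule matrix_eq_0_if_span[OF span_V[OF z(1) r(1)]])
    then have "C0 \<in> P" using D subspace_scale[OF subspace] by simp
    then show ?thesis by (rule C0P)
  qed
qed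

end

section \<open>Linear factors and the symplectic form\<close>

lemma span_singleton_iff: "(x \<in> span {l}) = (\<exists>k. x = k *\<^sub>R l)"
  by (auto simp: span_singleton)

lemma not_in_span_singletonE:
  fixes n l :: "'a::euclidean_space"
  assumes "n \<notin> span {l}"
  obtains x where "l \<bullet> x = 0" "n \<bullet> x \<noteq> 0"
  using in_span_if_orthogonal[of "{l}" n] assms by auto

definition sym_outer :: "real ^ 'n \<Rightarrow> real ^ 'n \<Rightarrow> real ^ 'n ^ 'n" where
  "sym_outer u v = (\<chi> i j. u $ i * v $ j + v $ i * u $ j)"

lemma sym_outer_mult: "sym_outer u v *v x = (v \<bullet> x) *\<^sub>R u + (u \<bullet> x) *\<^sub>R v"
  by (simp add: sym_outer_def matrix_vector_mult_def vec_eq_iff inner_vec_def sum.distrib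
      sum_distrib_left algebra_simps)

lemma quad_form_sym_outer: "quad_form (sym_outer u v) x = 2 * ((u \<bullet> x) * (v \<bullet> x))"
  by (simp add: quad_form_def sym_outer_mult inner_add_right inner_commute)

lemma sym_matrix_sym_outer: "sym_matrix (sym_outer u v)"
  by (simp add: sym_matrix_def sym_outer_def transpose_def vec_eq_iff)

text \<open>Two zeros \<open>p\<close> and \<open>q\<close> on a line where \<open>D\<close> changes
  sign form a hyperbolic pair. Then \<open>D *v p\<close> and \<open>D *v q\<close> span the range,
  and the coordinates of \<open>D *v x\<close> are read off by pairing with \<open>q\<close> and
  \<open>p\<close>.\<close>

lemma rank_2_factor:
  fixes D :: "real ^ 'n ^ 'n"
  assumes "sym_matrix D" "rank D = 2" "quad_form D a > 0" "quad_form D b < 0"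
  obtains l m where "D = sym_outer l m"
proof -
  obtain s t where st: "s < 0" "0 < t" "quad_form D (a + s *\<^sub>R b) = 0" "quad_form D (a + t *\<^sub>R b) = 0"
    "(D *v (a + s *\<^sub>R b)) \<bullet> b \<noteq> 0"
    using quad_form_roots[OF assms(1,3,4)] by metis
  define p q where "p = a + s *\<^sub>R b" and "q = a + t *\<^sub>R b"
  have q: "q = p + (t - s) *\<^sub>R b" by (simp add: p_def q_def algebra_simps)
  have pp: "(D *v p) \<bullet> p = 0" "(D *v q) \<bullet> q = 0"
    using st by (simp_all add: p_def q_def quad_form_def inner_commute)
  define c where "c = (D *v p) \<bullet> q"
  have "c = (t - s) * ((D *v p) \<bullet> b)" using pp unfolding c_def q by (simp add: inner_add_right)
  then have c: "c \<noteq> 0" using st by (simp add: p_def)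
  have c': "(D *v q) \<bullet> p = c" by (metis c_def inner_commute sym_matrix_inner[OF assms(1)])
  have "D *v p \<notin> span {D *v q}" using pp c by (auto simp: span_singleton_iff c_def)
  moreover have "D *v q \<noteq> 0" using c c' by auto
  moreover have "D *v p \<noteq> D *v q" using pp c by (auto simp: c_def)
  ultimately have "independent {D *v p, D *v q}" "card {D *v p, D *v q} = 2"
    by (simp_all add: independent_insert)
  then have rng: "range ((*v) D) \<subseteq> span {D *v p, D *v q}"
    using assms(2) by (intro card_ge_dim_independent) (auto simp: rank_dim_range)
  have "D *v x = sym_outer ((1 / c) *\<^sub>R (D *v p)) (D *v q) *v x" for x
  proof -
    obtain \<alpha> \<beta> where ab: "D *v x = \<alpha> *\<^sub>R (D *v p) + \<beta> *\<^sub>R (D *v q)" using rng in_span2 by blast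
    have "(D *v p) \<bullet> x = (D *v x) \<bullet> p" by (metis inner_commute sym_matrix_inner[OF assms(1)])
    also have "\<dots> = \<beta> * c" by (simp add: ab inner_add_left pp c')
    finally have 1: "(D *v p) \<bullet> x = \<beta> * c" .
    have "(D *v q) \<bullet> x = (D *v x) \<bullet> q" by (metis inner_commute sym_matrix_inner[OF assms(1)])
    also have "\<dots> = \<alpha> * c" by (simp add: ab inner_add_left pp flip: c_def)
    finally have 2: "(D *v q) \<bullet> x = \<alpha> * c" .
    show ?thesis using c by (simp add: sym_outer_mult 1 2 ab)
  qed
  then have "D = sym_outer ((1 / c) *\<^sub>R (D *v p)) (D *v q)" unfolding matrix_eq by blast
  then show thesis by (rule that)
qed

text \<open>The expression has its minimum 0 at \<open>s = 0\<close>, so its derivative there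
  vanishes.\<close>

lemma linear_coeff_zero:
  fixes \<beta> \<gamma> :: real
  assumes "\<And>s. 2 * s * \<beta> + s\<^sup>2 * \<gamma> \<ge> 0"
  shows "\<beta> = 0"
proof (rule ccontr)
  assume "\<beta> \<noteq> 0"
  define g where "g = \<bar>\<gamma>\<bar> + 1"
  have g: "g > 0" "\<gamma> < g" by (auto simp: g_def)
  have "2 * (- \<beta> / g) * \<beta> + (- \<beta> / g)\<^sup>2 * \<gamma> = (\<beta>\<^sup>2 / g\<^sup>2) * (\<gamma> - 2 * g)"
    using g by (simp add: field_simps power2_eq_square)
  also have "\<dots> < 0" using g \<open>\<beta> \<noteq> 0\<close> by (intro mult_pos_neg) auto
  finally show False using assms[of "- \<beta> / g"] by simp
qed

text \<open>The standard complex structure, with the sign for which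
  \<open>symplectic_form v w = v \<bullet> hamvec w\<close>.\<close>

definition hamvec :: "real ^ ('d::finite + 'd) \<Rightarrow> real ^ ('d + 'd)" where
  "hamvec w = (\<chi> i. case i of Inl j \<Rightarrow> - w $ Inr j | Inr j \<Rightarrow> w $ Inl j)"

lemma hamvec_hamvec: "hamvec (hamvec w) = - w"
  by (simp add: hamvec_def vec_eq_iff split: sum.split)

lemma symplectic_form_eq_inner: "symplectic_form v w = v \<bullet> hamvec w"
proof -
  have "v \<bullet> hamvec w = (\<Sum>i\<in>UNIV <+> UNIV. v $ i * hamvec w $ i)"
    by (simp only: inner_vec_def UNIV_Plus_UNIV inner_real_def)
  also have "\<dots> = (\<Sum>j\<in>UNIV. v $ Inl j * - w $ Inr j) + (\<Sum>j\<in>UNIV. v $ Inr j * w $ Inl j)"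
    by (subst sum.Plus) (simp_all add: hamvec_def)
  finally show ?thesis by (simp add: symplectic_form_def sum_subtractf sum_negf)
qed

lemma symplectic_form_antisym: "symplectic_form v w = - symplectic_form w v"
  by (simp add: symplectic_form_def sum_negf[symmetric] mult.commute)

lemma symplectic_form_add_left: "symplectic_form (u + v) w = symplectic_form u w + symplectic_form v w"
  by (simp add: symplectic_form_eq_inner inner_add_left)

lemma symplectic_form_scaleR_left: "symplectic_form (c *\<^sub>R v) w = c * symplectic_form v w"
  by (simp add: symplectic_form_eq_inner)

lemma symplectic_form_add_right: "symplectic_form w (u + v) = symplectic_form w u + symplectic_form w v"
  by (metis symplectic_form_add_left symplectic_form_antisym minus_add_distrib)

lemma symplectic_form_scaleR_right: "symplectic_form w (c *\<^sub>R v) = c * symplectic_form w v"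
  by (metis symplectic_form_scaleR_left symplectic_form_antisym mult_minus_right)

lemma symplectic_form_self: "symplectic_form v v = 0"
  using symplectic_form_antisym[of v v] by simp

lemma inner_hamvec_self: "m \<bullet> hamvec m = 0"
  by (metis symplectic_form_eq_inner symplectic_form_self)

section \<open>Poisson brackets of quadratic forms\<close>

lemma partial_deriv_quad_form:
  assumes "sym_matrix F"
  shows "partial_deriv i (quad_form F) z = 2 * (F *v z) $ i"
proof -
  have "((\<lambda>t. quad_form F z + t * (2 * (F *v z) $ i) + t\<^sup>2 * quad_form F (axis i 1))
      has_real_derivative 2 * (F *v z) $ i) (at 0)"
    by (auto intro!: derivative_eq_intros)
  moreover have "quad_form F (z + t *\<^sub>R axis i 1)
      = quad_form F z + t * (2 * (F *v z) $ i) + t\<^sup>2 * quad_form F (axis i 1)" for t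
    by (simp add: quad_form_add[OF assms] quad_form_scaleR inner_axis)
  ultimately show ?thesis unfolding partial_deriv_def by (simp add: DERIV_imp_deriv)
qed

lemma poisson_bracket_quad_form:
  assumes "sym_matrix A" "sym_matrix B"
  shows "poisson_bracket (quad_form A) (quad_form B) z = 4 * symplectic_form (A *v z) (B *v z)"
  by (simp add: poisson_bracket_def symplectic_form_def partial_deriv_quad_form assms sum_distrib_left
      right_diff_distrib mult.assoc)

section \<open>Condition (ii): pencils containing a form of rank 2\<close>

text \<open>Finsler's lemma for both signs of the product makes it a multiple of \<open>E\<close> on
  the hyperplane \<open>l = 0\<close>. The factor is 0, since otherwise \<open>E\<close> would
  vanish where \<open>l\<close> and \<open>m\<close> do and have rank at most 4. So the product
  vanishes on the hyperplane, and since \<open>m\<close> does not, \<open>n\<close> does.\<close>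

lemma factor_of_vanishing:
  fixes E :: "real ^ 'n ^ 'n"
  assumes symE: "sym_matrix E" "rank E \<ge> 5" and "m \<notin> span {l}"
    and a: "l \<bullet> a = 0" "quad_form E a > 0" and b: "l \<bullet> b = 0" "quad_form E b < 0"
    and vanish: "\<And>x. l \<bullet> x = 0 \<Longrightarrow> quad_form E x = 0 \<Longrightarrow> (m \<bullet> x) * (n \<bullet> x) = 0"
  shows "n \<in> span {l}"
proof (rule ccontr)
  assume n: "n \<notin> span {l}"
  let ?S = "{x. l \<bullet> x = 0}" and ?G = "sym_outer m n"
  have sub: "subspace ?S" by (rule subspace_hyperplane)
  have "quad_form ?G x \<ge> 0" "quad_form (- ?G) x \<ge> 0" if "x \<in> ?S" "quad_form E x = 0" for x
    using vanish[of x] that by (auto simp: quad_form_sym_outer quad_form_matrix_uminus)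
  note nonneg = this
  have S: "a \<in> ?S" "b \<in> ?S" using a b by auto
  obtain t where t: "\<And>x. x \<in> ?S \<Longrightarrow> quad_form ?G x \<ge> t * quad_form E x"
    using finsler[OF sym_matrix_sym_outer symE(1) sub S(1) a(2) S(2) b(2) nonneg(1)] by blast
  obtain t' where t': "\<And>x. x \<in> ?S \<Longrightarrow> quad_form (- ?G) x \<ge> t' * quad_form E x"
    using finsler[OF sym_matrix_uminus[OF sym_matrix_sym_outer] symE(1) sub S(1) a(2) S(2) b(2) nonneg(2)] by blast
  have "(t + t') * quad_form E x \<le> 0" if "x \<in> ?S" for x
    using t[OF that] t'[OF that] by (simp add: quad_form_matrix_uminus distrib_right)
  from this[of a] this[of b] have "t' = - t" using a b by (simp add: mult_le_0_iff)
  then have eq: "2 * ((m \<bullet> x) * (n \<bullet> x)) = t * quad_form E x" if "l \<bullet> x = 0" for x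
    using t[of x] t'[of x] that by (simp add: quad_form_matrix_uminus quad_form_sym_outer)
  have "t = 0"
  proof (rule ccontr)
    assume "t \<noteq> 0"
    have "rank E \<le> 2 * card {l, m}"
    proof (intro rank_quad_form_zero symE(1))
      fix x assume "\<And>a. a \<in> {l, m} \<Longrightarrow> a \<bullet> x = 0"
      then have "l \<bullet> x = 0" "m \<bullet> x = 0" by auto
      then show "quad_form E x = 0" using eq[of x] \<open>t \<noteq> 0\<close> by simp
    qed auto
    also have "\<dots> \<le> 2 * 2" by (intro mult_le_mono) (simp_all add: card_insert_if)
    finally show False using symE(2) by simp
  qed
  then have prod: "m \<bullet> x = 0 \<or> n \<bullet> x = 0" if "l \<bullet> x = 0" for x using eq[OF that] by simp
  obtain x y where "l \<bullet> x = 0" "n \<bullet> x \<noteq> 0" "l \<bullet> y = 0" "m \<bullet> y \<noteq> 0"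
    using n assms(3) by (metis not_in_span_singletonE)
  then show False using prod[of x] prod[of y] prod[of "x + y"] by (simp add: inner_add_right)
qed

text \<open>If \<open>hamvec m\<close> is transversal to \<open>l = 0\<close>, splitting along it
  shows that \<open>E\<close> minus a multiple of the product of \<open>l\<close> and
  \<open>m\<close> is positive semidefinite. If it lies in \<open>l = 0\<close>, it minimizes
  \<open>E\<close> there, so \<mu> = 0; then \<open>hamvec m\<close> is in the radical and
  symplectically orthogonal to it, against \<open>rad\<close>.\<close>

lemma semidefinite_contradiction:
  fixes E :: "real ^ ('d::finite + 'd) ^ ('d + 'd)"
  assumes symE: "sym_matrix E" and m: "m \<notin> span {l}"
    and nonneg: "\<And>x. l \<bullet> x = 0 \<Longrightarrow> quad_form E x \<ge> 0"
    and Em: "E *v hamvec m = \<mu> *\<^sub>R m"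
    and rad: "{z. l \<bullet> z = 0 \<and> m \<bullet> z = 0 \<and> E *v z = 0} = {0} \<or>
      symplectic_subspace {z. l \<bullet> z = 0 \<and> m \<bullet> z = 0 \<and> E *v z = 0}"
    and nd: "\<And>t. \<exists>x. quad_form E x + t * ((l \<bullet> x) * (m \<bullet> x)) < 0"
  shows False
proof (cases "l \<bullet> hamvec m = 0")
  case False
  define \<kappa> where "\<kappa> = l \<bullet> hamvec m"
  have \<kappa>: "\<kappa> \<noteq> 0" using False by (simp add: \<kappa>_def)
  obtain x where x: "quad_form E x + (- 2 * \<mu> / \<kappa>) * ((l \<bullet> x) * (m \<bullet> x)) < 0" using nd by blast
  define c where "c = (l \<bullet> x) / \<kappa>"
  define y where "y = x - c *\<^sub>R hamvec m"
  have "l \<bullet> y = 0" using \<kappa> by (simp add: y_def c_def inner_diff_right flip: \<kappa>_def)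
  then have "quad_form E y \<ge> 0" by (rule nonneg)
  moreover have "quad_form E x = quad_form E y + 2 * (c * (\<mu> * (m \<bullet> x)))"
  proof -
    have "x = c *\<^sub>R hamvec m + y" by (simp add: y_def)
    then have "quad_form E x = c\<^sup>2 * quad_form E (hamvec m) + 2 * (c * (\<mu> * (m \<bullet> y))) + quad_form E y"
      by (simp add: quad_form_add[OF symE] quad_form_scaleR matrix_vector_mult_scaleR Em)
    moreover have "quad_form E (hamvec m) = 0"
      by (simp add: quad_form_def Em inner_commute inner_hamvec_self)
    moreover have "m \<bullet> y = m \<bullet> x" by (simp add: y_def inner_diff_right inner_hamvec_self)
    ultimately show ?thesis by simp
  qed
  ultimately show False using x by (simp add: c_def)
next
  case True
  have JE: "(E *v hamvec m) \<bullet> y = 0" if "l \<bullet> y = 0" for y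
  proof (rule linear_coeff_zero)
    fix s :: real
    have "quad_form E (hamvec m + s *\<^sub>R y) \<ge> 0" using True that by (intro nonneg) (simp add: inner_add_right)
    moreover have "quad_form E (hamvec m) = 0"
      by (simp add: quad_form_def Em inner_commute inner_hamvec_self)
    ultimately show "2 * s * ((E *v hamvec m) \<bullet> y) + s\<^sup>2 * quad_form E y \<ge> 0"
      by (simp add: quad_form_add[OF symE] quad_form_scaleR)
  qed
  have "\<mu> = 0"
  proof (rule ccontr)
    assume "\<mu> \<noteq> 0"
    obtain y where "l \<bullet> y = 0" "m \<bullet> y \<noteq> 0" using m by (rule not_in_span_singletonE)
    then show False using JE[of y] \<open>\<mu> \<noteq> 0\<close> by (simp add: Em)
  qed
  let ?R = "{z. l \<bullet> z = 0 \<and> m \<bullet> z = 0 \<and> E *v z = 0}"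
  have R: "hamvec m \<in> ?R" using True Em \<open>\<mu> = 0\<close> by (simp add: inner_hamvec_self)
  have "m \<noteq> 0" using m span_zero by blast
  have "symplectic_form (hamvec m) w = w \<bullet> m" for w
    using symplectic_form_antisym[of "hamvec m" w] symplectic_form_eq_inner[of w "hamvec m"]
    by (simp add: hamvec_hamvec)
  then have "\<forall>w\<in>?R. symplectic_form (hamvec m) w = 0" by (simp add: inner_commute)
  then have "hamvec m = 0" using rad R unfolding symplectic_subspace_def by blast
  then have "hamvec (hamvec m) = 0" by (simp add: hamvec_def vec_eq_iff split: sum.split)
  then show False using \<open>m \<noteq> 0\<close> by (simp add: hamvec_hamvec)
qed

text \<open>On a hyperplane where \<open>E\<close> is indefinite, \<open>factor_of_vanishing\<close>
  applies. Semidefiniteness on both hyperplanes is impossible: equal signs yield a semidefinite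
  combination by Finsler's lemma, opposite signs force rank at most 4. The eigenvector from one
  hyperplane then excludes semidefiniteness on the other by
  \<open>semidefinite_contradiction\<close>.\<close>

lemma factor_eigenvectors:
  fixes E :: "real ^ ('d::finite + 'd) ^ ('d + 'd)"
  assumes E: "sym_matrix E" "rank E \<ge> 5" and lm: "m \<notin> span {l}" "l \<notin> span {m}"
    and D: "quad_form (sym_outer l m) a > 0" "quad_form (sym_outer l m) b < 0"
    and nd_neg: "\<And>t. \<exists>x. quad_form E x + t * ((l \<bullet> x) * (m \<bullet> x)) < 0"
    and nd_pos: "\<And>t. \<exists>x. quad_form E x + t * ((l \<bullet> x) * (m \<bullet> x)) > 0"
    and vanish: "\<And>x. (l \<bullet> x) * (m \<bullet> x) = 0 \<Longrightarrow> quad_form E x = 0 \<Longrightarrow>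
      (l \<bullet> x) * ((E *v hamvec m) \<bullet> x) + (m \<bullet> x) * ((E *v hamvec l) \<bullet> x) = 0"
    and rad: "{z. l \<bullet> z = 0 \<and> m \<bullet> z = 0 \<and> E *v z = 0} = {0} \<or>
      symplectic_subspace {z. l \<bullet> z = 0 \<and> m \<bullet> z = 0 \<and> E *v z = 0}"
  shows "E *v hamvec l \<in> span {l} \<and> E *v hamvec m \<in> span {m}"
proof -
  define semi where "semi = (\<lambda>F n. \<forall>x :: real ^ ('d + 'd). n \<bullet> x = 0 \<longrightarrow> quad_form F x \<ge> 0)"
  have half_l: "E *v hamvec l \<in> span {l}" if ns: "\<not> semi E l" "\<not> semi (- E) l"
  proof -
    obtain x where x: "l \<bullet> x = 0" "quad_form E x < 0"
      using ns(1) by (auto simp: semi_def not_le)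
    obtain y where y: "l \<bullet> y = 0" "quad_form E y > 0"
      using ns(2) by (auto simp: semi_def quad_form_matrix_uminus not_le)
    have "(m \<bullet> x) * ((E *v hamvec l) \<bullet> x) = 0" if "l \<bullet> x = 0" "quad_form E x = 0" for x
      using vanish[of x] that by simp
    then show ?thesis by (rule factor_of_vanishing[OF E lm(1) y x])
  qed
  have half_m: "E *v hamvec m \<in> span {m}" if ns: "\<not> semi E m" "\<not> semi (- E) m"
  proof -
    obtain x where x: "m \<bullet> x = 0" "quad_form E x < 0"
      using ns(1) by (auto simp: semi_def not_le)
    obtain y where y: "m \<bullet> y = 0" "quad_form E y > 0"
      using ns(2) by (auto simp: semi_def quad_form_matrix_uminus not_le)
    have "(l \<bullet> x) * ((E *v hamvec m) \<bullet> x) = 0" if "m \<bullet> x = 0" "quad_form E x = 0" for x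
      using vanish[of x] that by simp
    then show ?thesis by (rule factor_of_vanishing[OF E lm(2) y x])
  qed
  have neg: "(- E) *v x = - (E *v x)" for x using matrix_vector_mult_diff_rdistrib[of 0 E x] by simp
  have nd_neg': "\<exists>x. quad_form (- E) x + t * ((l \<bullet> x) * (m \<bullet> x)) < 0" for t
  proof -
    obtain x where "quad_form E x + (- t) * ((l \<bullet> x) * (m \<bullet> x)) > 0" using nd_pos by blast
    then show ?thesis by (intro exI[of _ x]) (simp add: quad_form_matrix_uminus)
  qed
  have no_semi: False if F: "F = E \<or> F = - E" "semi F p" and ev: "E *v hamvec q \<in> span {q}"
    and pq: "(p = l \<and> q = m) \<or> (p = m \<and> q = l)" for F p q
  proof -
    obtain \<mu> where "E *v hamvec q = \<mu> *\<^sub>R q" using ev by (auto simp: span_singleton_iff)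
    then obtain \<nu> where \<nu>: "F *v hamvec q = \<nu> *\<^sub>R q" using F(1) by (metis neg scaleR_minus_left)
    have "F *v z = 0 \<longleftrightarrow> E *v z = 0" for z using F(1) by (auto simp: neg)
    then have R: "{z. p \<bullet> z = 0 \<and> q \<bullet> z = 0 \<and> F *v z = 0} = {z. l \<bullet> z = 0 \<and> m \<bullet> z = 0 \<and> E *v z = 0}"
      using pq by auto
    show False
    proof (rule semidefinite_contradiction[OF _ _ _ \<nu>])
      show "sym_matrix F" using F(1) E(1) sym_matrix_uminus by blast
      show "q \<notin> span {p}" using lm pq by auto
      show "quad_form F x \<ge> 0" if "p \<bullet> x = 0" for x using F(2) that by (simp add: semi_def)
      show "{z. p \<bullet> z = 0 \<and> q \<bullet> z = 0 \<and> F *v z = 0} = {0} \<or>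
          symplectic_subspace {z. p \<bullet> z = 0 \<and> q \<bullet> z = 0 \<and> F *v z = 0}"
        unfolding R by (rule rad)
      have "(p \<bullet> x) * (q \<bullet> x) = (l \<bullet> x) * (m \<bullet> x)" for x using pq by auto
      then show "\<exists>x. quad_form F x + t * ((p \<bullet> x) * (q \<bullet> x)) < 0" for t
        using F(1) nd_neg nd_neg' by metis
    qed
  qed
  have same: False if F: "semi F l" "semi F m" "F = E \<or> F = - E" for F
  proof -
    have symF: "sym_matrix F" using F E(1) sym_matrix_uminus by blast
    have "quad_form F x \<ge> 0" if "x \<in> UNIV" "quad_form (sym_outer l m) x = 0" for x
      using that F by (auto simp: semi_def quad_form_sym_outer)
    then obtain t where t: "\<And>x. x \<in> UNIV \<Longrightarrow> quad_form F x \<ge> t * quad_form (sym_outer l m) x"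
      using finsler[OF symF sym_matrix_sym_outer subspace_UNIV UNIV_I D(1) UNIV_I D(2)] by blast
    obtain x where "quad_form F x + (- 2 * t) * ((l \<bullet> x) * (m \<bullet> x)) < 0"
      using F(3) nd_neg[of "- 2 * t"] nd_neg'[of "- 2 * t"] by blast
    then show False using t[of x] by (simp add: quad_form_sym_outer)
  qed
  have opposite: False if F: "semi F l" "semi (- F) m" "F = E \<or> F = - E" for F
  proof -
    have symF: "sym_matrix F" using F E(1) sym_matrix_uminus by blast
    have "rank F \<le> 2 * card {l, m}"
    proof (intro rank_quad_form_zero symF)
      fix x assume "\<And>a. a \<in> {l, m} \<Longrightarrow> a \<bullet> x = 0"
      then have "l \<bullet> x = 0" "m \<bullet> x = 0" by auto
      then have "quad_form F x \<ge> 0" "quad_form (- F) x \<ge> 0" using F(1,2) unfolding semi_def by blast+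
      then show "quad_form F x = 0" by (simp add: quad_form_matrix_uminus)
    qed auto
    also have "\<dots> \<le> 2 * 2" by (intro mult_le_mono) (simp_all add: card_insert_if)
    finally have "rank F \<le> 4" by simp
    moreover have "rank E \<le> rank F" using F(3) rank_scaleR_le[of "-1" F] by auto
    ultimately show False using E(2) by simp
  qed
  have "\<not> semi E l \<and> \<not> semi (- E) l \<or> \<not> semi E m \<and> \<not> semi (- E) m"
    using same[of E] same[of "- E"] opposite[of E] opposite[of "- E"] by auto
  then show ?thesis
    using half_l half_m no_semi[of E l m] no_semi[of "- E" l m] no_semi[of E m l] no_semi[of "- E" m l] by blast
qed

text \<open>By antisymmetry only the determinant of the change of basis survives, so the bracket may
  be computed in any basis of the pencil.\<close>

lemma symplectic_form_combination:
  assumes "D = p *\<^sub>R A + q *\<^sub>R B" "E = r *\<^sub>R A + t *\<^sub>R B"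
  shows "symplectic_form (D *v z) (E *v z) = (p * t - q * r) * symplectic_form (A *v z) (B *v z)"
proof -
  have "symplectic_form (D *v z) (E *v z) =
      p * t * symplectic_form (A *v z) (B *v z) + q * r * symplectic_form (B *v z) (A *v z)"
    by (simp add: assms matrix_vector_mult_add_rdistrib symplectic_form_add_left symplectic_form_add_right
        symplectic_form_scaleR_left symplectic_form_scaleR_right symplectic_form_self
        flip: scaleR_matrix_vector_assoc)
  then show ?thesis using symplectic_form_antisym[of "B *v z" "A *v z"] by (simp add: algebra_simps)
qed

lemma sym_outer_nondegenerate:
  assumes "quad_form (sym_outer l m) a > 0" "quad_form (sym_outer l m) b < 0"
  shows "m \<notin> span {l}"
proof
  assume "m \<in> span {l}"
  then obtain k where k: "m = k *\<^sub>R l" by (auto simp: span_singleton_iff)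
  have "k * (l \<bullet> a)\<^sup>2 > 0" "k * (l \<bullet> b)\<^sup>2 < 0"
    using assms by (simp_all add: quad_form_sym_outer k power2_eq_square mult.left_commute)
  then show False by (simp add: zero_less_mult_iff mult_less_0_iff)
qed

text \<open>With \<open>D\<close> factored into \<open>l\<close> and \<open>m\<close>, the product
  rule expresses the bracket through \<open>E *v hamvec l\<close> and \<open>E *v hamvec m\<close>.
  Once these are multiples of \<open>l\<close> and \<open>m\<close>, both terms are multiples of the
  product of the two factors.\<close>

lemma symplectic_vanishing_in_pencil:
  fixes P :: "(real ^ ('d::finite + 'd) ^ ('d + 'd)) set"
  assumes "pencil P" and nd: "\<And>M. M \<in> P \<Longrightarrow> M \<noteq> 0 \<Longrightarrow> \<exists>x. quad_form M x > 0"
    and D: "D \<in> P" "rank D = 2" and E: "E \<in> P" "rank E \<ge> 5"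
    and rad: "{z. D *v z = 0 \<and> E *v z = 0} = {0} \<or> symplectic_subspace {z. D *v z = 0 \<and> E *v z = 0}"
    and vanish: "\<And>y. y \<in> isotropic P \<Longrightarrow> symplectic_form (D *v y) (E *v y) = 0"
  obtains k where "\<And>z. symplectic_form (D *v z) (E *v z) = k * quad_form D z"
proof -
  interpret pencil P by fact
  have D0: "D \<noteq> 0" using D by auto
  have neg: "- M \<in> P" if "M \<in> P" for M using that subspace_neg[OF subspace] by blast
  obtain a where a: "quad_form D a > 0" using nd D D0 by blast
  have "\<exists>b. quad_form (- D) b > 0" using neg[OF D(1)] D0 by (intro nd) auto
  then obtain b where b: "quad_form D b < 0" by (auto simp: quad_form_matrix_uminus)
  obtain l m where lm: "D = sym_outer l m" using rank_2_factor[OF sym[OF D(1)] D(2) a b] by blast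
  have comm: "sym_outer l m = sym_outer m l" by (simp add: sym_outer_def vec_eq_iff add.commute)
  have l: "m \<notin> span {l}" using sym_outer_nondegenerate a b unfolding lm by blast
  have m: "l \<notin> span {m}" using sym_outer_nondegenerate a b unfolding lm comm by blast
  have ED: "E \<noteq> c *\<^sub>R D" for c using rank_scaleR_le[of c D] D(2) E(2) by auto
  have ker: "D *v z = 0 \<longleftrightarrow> l \<bullet> z = 0 \<and> m \<bullet> z = 0" for z
  proof
    assume "D *v z = 0"
    then have 0: "(m \<bullet> z) *\<^sub>R l + (l \<bullet> z) *\<^sub>R m = 0" by (simp add: lm sym_outer_mult)
    obtain x where "l \<bullet> x = 0" "m \<bullet> x \<noteq> 0" using l by (rule not_in_span_singletonE)
    then have "l \<bullet> z = 0" using arg_cong[OF 0, of "\<lambda>u. u \<bullet> x"] by (simp add: inner_add_left)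
    moreover obtain y where "m \<bullet> y = 0" "l \<bullet> y \<noteq> 0" using m by (rule not_in_span_singletonE)
    then have "m \<bullet> z = 0" using arg_cong[OF 0, of "\<lambda>u. u \<bullet> y"] by (simp add: inner_add_left)
    ultimately show "l \<bullet> z = 0 \<and> m \<bullet> z = 0" by blast
  qed (simp add: lm sym_outer_mult)
  have form: "symplectic_form (D *v z) (E *v z) =
      - ((l \<bullet> z) * ((E *v hamvec m) \<bullet> z) + (m \<bullet> z) * ((E *v hamvec l) \<bullet> z))" for z
  proof -
    have eq: "symplectic_form w (E *v z) = - ((E *v hamvec w) \<bullet> z)" for w
    proof -
      have "symplectic_form w (E *v z) = - ((E *v z) \<bullet> hamvec w)"
        using symplectic_form_antisym[of w "E *v z"] by (simp add: symplectic_form_eq_inner[of "E *v z"])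
      then show ?thesis by (metis inner_commute sym_matrix_inner[OF sym[OF E(1)]])
    qed
    have "symplectic_form (D *v z) (E *v z) =
        (m \<bullet> z) * symplectic_form l (E *v z) + (l \<bullet> z) * symplectic_form m (E *v z)"
      by (simp add: lm sym_outer_mult symplectic_form_add_left symplectic_form_scaleR_left)
    then show ?thesis by (simp add: eq)
  qed
  have comb: "E + t *\<^sub>R D \<in> P" "E + t *\<^sub>R D \<noteq> 0" for t
    using subspace_add[OF subspace E(1) subspace_scale[OF subspace D(1)]] ED[of "- t"]
    by (auto simp: eq_neg_iff_add_eq_0)
  \<comment> \<open>The scalar \<open>t / 2\<close> appears because \<open>quad_form D\<close> is
    twice the product of the linear forms.\<close>
  have "\<exists>x. quad_form E x + t * ((l \<bullet> x) * (m \<bullet> x)) > 0" for t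
    using nd[OF comb[of "t / 2"]]
    by (simp add: quad_form_matrix_add quad_form_matrix_scaleR lm quad_form_sym_outer)
  moreover have "\<exists>x. quad_form E x + t * ((l \<bullet> x) * (m \<bullet> x)) < 0" for t
  proof -
    have "\<exists>x. quad_form (- (E + (t / 2) *\<^sub>R D)) x > 0"
      using neg[OF comb(1)] comb(2) by (intro nd) (auto simp only: neg_equal_0_iff_equal)
    then obtain x where "quad_form (- (E + (t / 2) *\<^sub>R D)) x > 0" by blast
    then have "quad_form E x + t * ((l \<bullet> x) * (m \<bullet> x)) < 0"
      by (simp only: quad_form_matrix_uminus quad_form_matrix_add quad_form_matrix_scaleR lm quad_form_sym_outer)
    then show ?thesis by blast
  qed
  moreover have "(l \<bullet> x) * ((E *v hamvec m) \<bullet> x) + (m \<bullet> x) * ((E *v hamvec l) \<bullet> x) = 0"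
    if "(l \<bullet> x) * (m \<bullet> x) = 0" "quad_form E x = 0" for x
  proof -
    have "quad_form D x = 0" using that by (simp add: lm quad_form_sym_outer)
    then have "x \<in> isotropic P" using isotropicI[OF D(1) D0 E(1) ED] that by blast
    then show ?thesis using vanish[of x] form[of x] by linarith
  qed
  moreover have "{z. l \<bullet> z = 0 \<and> m \<bullet> z = 0 \<and> E *v z = 0} = {0} \<or>
      symplectic_subspace {z. l \<bullet> z = 0 \<and> m \<bullet> z = 0 \<and> E *v z = 0}"
    using rad by (simp add: ker)
  ultimately have "E *v hamvec l \<in> span {l} \<and> E *v hamvec m \<in> span {m}"
    using a b unfolding lm by (intro factor_eigenvectors[OF sym[OF E(1)] E(2) l m])
  then obtain \<mu> \<nu> where "E *v hamvec l = \<mu> *\<^sub>R l" "E *v hamvec m = \<nu> *\<^sub>R m"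
    by (auto simp: span_singleton_iff)
  then have "symplectic_form (D *v z) (E *v z) = (- (\<mu> + \<nu>) / 2) * quad_form D z" for z
    unfolding form by (simp add: lm quad_form_sym_outer algebra_simps)
  then show thesis by (rule that)
qed

section \<open>Reduction of the theorem to the two conditions\<close>

theorem theorem1p3:
  fixes A B C :: "real ^ ('d::finite + 'd) ^ ('d + 'd)"
  assumes "sym_matrix A" and "sym_matrix B"
    and "distinct [A, B]" and "independent {A, B}"
    and "non_dissipative A B"
    and "sym_matrix C"
    and "\<And>z. quad_form C z = poisson_bracket (quad_form A) (quad_form B) z"
    and "distinct [A, B, C]" and "independent {A, B, C}"
    and "(minrank A B \<ge> 3 \<and> maxrank A B \<ge> 17) \<or>
         (minrank A B = 2 \<and> maxrank A B \<ge> 9 \<and>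
           (joint_radical A B = {0} \<or> symplectic_subspace (joint_radical A B)))"
  shows "\<exists>x. quad_form A x = 0 \<and> quad_form B x = 0 \<and> quad_form C x \<noteq> 0"
proof (rule ccontr)
  assume contra: "\<not> ?thesis"
  define P where "P = span {A, B}"
  have AB: "A \<in> P" "B \<in> P" by (auto simp: P_def span_base)
  have symP: "sym_matrix M" if "M \<in> P" for M
  proof -
    obtain a b where "M = a *\<^sub>R A + b *\<^sub>R B" using \<open>M \<in> P\<close> by (auto simp: P_def in_span2)
    then show ?thesis using assms(1,2) by (simp add: sym_matrix_add sym_matrix_scaleR)
  qed
  have "dim P = 2"
    using assms(3,4) by (simp add: P_def dim_eq_card_independent)
  then interpret pencil P
    by unfold_locales (use symP in \<open>auto simp: P_def\<close>)
  have A0: "A \<noteq> 0" using assms(4) dependent_zero[of "{A, B}"] by auto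
  have BA: "B \<noteq> c *\<^sub>R A" for c
  proof
    assume "B = c *\<^sub>R A"
    then have "B \<in> span {A}" by (auto simp: span_singleton_iff)
    moreover have "B \<notin> span {A}"
      using assms(3,4) independent_insert[of B "{A}"] by (auto simp: insert_commute split: if_splits)
    ultimately show False by blast
  qed
  have CP: "C \<notin> P"
  proof -
    have "{A, B, C} = insert C {A, B}" by auto
    then show ?thesis
      using assms(8,9) independent_insert[of C "{A, B}"] by (auto simp: P_def split: if_splits)
  qed
  have nd: "\<exists>x. quad_form M x > 0" if M: "M \<in> P" "M \<noteq> 0" for M
  proof -
    have "- M \<in> P" using M(1) subspace_neg[OF subspace] by blast
    then have "\<not> pos_semidef (- M)"
      using assms(5) M(2) unfolding non_dissipative_def P_def by (metis (mono_tags, lifting) mem_Collect_eq neg_equal_0_iff_equal singletonD)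
    then show ?thesis using symP[OF \<open>- M \<in> P\<close>]
      by (auto simp: pos_semidef_def quad_form_matrix_uminus not_le)
  qed
  have vanish: "quad_form C x = 0" if "x \<in> isotropic P" for x
    using contra that AB by (auto simp: isotropic_def)
  \<comment> \<open>Ranks are bounded, so the maximum and the minimum are attained although the sets
    of matrices are infinite.\<close>
  have "rank M \<in> {..CARD('d + 'd)}" for M :: "real ^ ('d + 'd) ^ ('d + 'd)"
    using rank_bound[of M] by simp
  then have "range (rank :: real ^ ('d + 'd) ^ ('d + 'd) \<Rightarrow> nat) \<subseteq> {..CARD('d + 'd)}"
    by (rule image_subsetI)
  then have "finite (range (rank :: real ^ ('d + 'd) ^ ('d + 'd) \<Rightarrow> nat))"
    by (rule finite_subset) simp
  then have fin: "finite (rank ` S)" for S :: "(real ^ ('d + 'd) ^ ('d + 'd)) set"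
    by (rule rev_finite_subset) auto
  have "maxrank A B \<in> rank ` P" unfolding maxrank_def P_def[symmetric] using AB fin by (intro Max_in) auto
  then obtain E where E: "E \<in> P" "rank E = maxrank A B" by auto
  from assms(10) show False
  proof
    assume i: "minrank A B \<ge> 3 \<and> maxrank A B \<ge> 17"
    have "rank M \<ge> 3" if "M \<in> P" "M \<noteq> 0" for M
    proof -
      have "minrank A B \<le> rank M" unfolding minrank_def P_def[symmetric] using that fin by (intro Min_le) auto
      then show ?thesis using i by simp
    qed
    then have "C \<in> P" using vanishing_in_pencil[OF nd _ E(1) _ assms(6) vanish] E(2) i by simp
    then show False using CP by blast
  next
    assume ii: "minrank A B = 2 \<and> maxrank A B \<ge> 9 \<and>
      (joint_radical A B = {0} \<or> symplectic_subspace (joint_radical A B))"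
    have "minrank A B \<in> rank ` (P - {0})"
      unfolding minrank_def P_def[symmetric] using AB A0 fin by (intro Min_in) auto
    then obtain D where "D \<in> P - {0}" "rank D = minrank A B" by (metis imageE)
    then have D: "D \<in> P" "D \<noteq> 0" "rank D = 2" using ii by simp_all
    have rankE: "rank E \<ge> 5" using E(2) ii by simp
    have ED: "E \<noteq> c *\<^sub>R D" for c using rank_scaleR_le[of c D] D(3) rankE by auto
    \<comment> \<open>Expressing each basis in the other transfers both the vanishing of the bracket
      and the joint radical between \<open>A\<close>, \<open>B\<close> and \<open>D\<close>,
      \<open>E\<close>.\<close>
    obtain p q where D': "D = p *\<^sub>R A + q *\<^sub>R B" using basis[OF AB(1) A0 AB(2) BA D(1)] by blast
    obtain r t where E': "E = r *\<^sub>R A + t *\<^sub>R B" using basis[OF AB(1) A0 AB(2) BA E(1)] by blast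
    obtain p' q' where A': "A = p' *\<^sub>R D + q' *\<^sub>R E" using basis[OF D(1,2) E(1) ED AB(1)] by blast
    obtain r' t' where B': "B = r' *\<^sub>R D + t' *\<^sub>R E" using basis[OF D(1,2) E(1) ED AB(2)] by blast
    have QC: "quad_form C z = 4 * symplectic_form (A *v z) (B *v z)" for z
      using assms(7) poisson_bracket_quad_form[OF assms(1,2)] by simp
    have "D *v z = 0 \<and> E *v z = 0 \<longleftrightarrow> A *v z = 0 \<and> B *v z = 0" for z
    proof
      assume "D *v z = 0 \<and> E *v z = 0"
      then show "A *v z = 0 \<and> B *v z = 0"
        by (subst A', subst B') (simp add: matrix_vector_mult_add_rdistrib flip: scaleR_matrix_vector_assoc)
    next
      assume "A *v z = 0 \<and> B *v z = 0"
      then show "D *v z = 0 \<and> E *v z = 0"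
        by (subst D', subst E') (simp add: matrix_vector_mult_add_rdistrib flip: scaleR_matrix_vector_assoc)
    qed
    then have rad: "{z. D *v z = 0 \<and> E *v z = 0} = joint_radical A B" by (auto simp: joint_radical_def)
    have "symplectic_form (D *v y) (E *v y) = 0" if "y \<in> isotropic P" for y
      using symplectic_form_combination[OF D' E', of y] vanish[OF that] QC[of y] by simp
    then obtain k where k: "\<And>z. symplectic_form (D *v z) (E *v z) = k * quad_form D z"
      using symplectic_vanishing_in_pencil[OF pencil_axioms nd D(1,3) E(1) rankE] ii unfolding rad by blast
    \<comment> \<open>The factor 4 comes from the bracket of quadratic forms,
      \<open>p' * t' - q' * r'\<close> from the passage from \<open>D\<close>, \<open>E\<close> to
      \<open>A\<close>, \<open>B\<close>.\<close>
    have "C - (4 * (p' * t' - q' * r') * k) *\<^sub>R D = 0"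
    proof (rule sym_matrix_eq_0)
      show "sym_matrix (C - (4 * (p' * t' - q' * r') * k) *\<^sub>R D)"
        using assms(6) symP[OF D(1)] by (simp add: sym_matrix_diff sym_matrix_scaleR)
      show "quad_form (C - (4 * (p' * t' - q' * r') * k) *\<^sub>R D) z = 0" for z
        using symplectic_form_combination[OF A' B', of z]
        by (simp add: quad_form_matrix_diff quad_form_matrix_scaleR QC k)
    qed
    then have "C \<in> P" using subspace_scale[OF subspace D(1)] by simp
    then show False using CP by blast
  qed
qed

end
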